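(* For the continuous CNN problem, the potential $\Phi$ is non-decreasing throughout the execution of the Bishop-Rook (BR) algorithm, and consequently on every input the total distance $\ell^{on}$ traveled by the BR server is at most $(3+2\sqrt3)\,\ell^{opt}$, where $\ell^{opt}$ is the distance traveled by an optimal offline server; i.e., the BR algorithm is $(3+2\sqrt3)$-competitive.
   Context: Two points of $\mathbb{R}^2$ are $x$-aligned (resp. $y$-aligned) if they share the $x$ (resp. $y$) coordinate; aligned means $x$- or $y$-aligned. All distances are $L_1$; $d(p,q)$ is the $L_1$ distance. Continuous CNN problem: a single server starts at the origin. The input is an online sequence of pairs $(p_i,\vec d_i)$, where $p_1$ is the origin, each $\vec d_i$ is a unit vector and $p_{i+1}$ lies on the ray $\{p_i+t\vec d_i:t\ge0\}$; the request moves continuously along the piecewise-linear trajectory $p_1\to p_2\to\cdots$, and the server must be aligned with the request at all times, moving continuously, committing to its motion along the current segment without knowledge of future pairs. Cost is total $L_1$ length traveled. BR algorithm: it alternates between a bishop phase and a rook phase, maintaining an offset vector $\vec o$, which is $0$ at the start of each bishop phase (a cycle is a bishop phase followed by a rook phase). Bishop phase: choose axes (by an orthogonal redrawing) so that the current request point is the origin and the server is at $(0,h)$ with $h\ge0$. The server keeps its $x$ coordinate equal to that of the request, and for every horizontal distance $|\delta x|$ it moves it simultaneously moves $|\delta x|$ in the $-y$ direction (so it moves diagonally at $45^\circ$); when the request moves vertically the server stays still. When the server and the request coincide, at a point $(s_x,s_y)$, the bishop phase ends and the offset is set to $\vec o=-s_x\vec x$, where $\vec x$ is the unit vector in the positive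 $x$ direction. Rook phase (axes reflected if necessary so that $\vec o$ points in the $-x$ direction): the server keeps the same $y$ coordinate as the request at all times, and keeps its $x$ coordinate $\le$ that of the request: while the request's $x$ coordinate is strictly larger, the server's $x$ coordinate is unchanged; when they coincide and the request moves in the $-x$ direction, the server moves with it. Whenever server and request move together a distance $t$ vertically, $|\vec o|$ decreases by $(1+\sqrt3)t$; whenever they move together a distance $t$ horizontally, $|\vec o|$ decreases by $t$; when the request moves but the server does not, $|\vec o|$ is unchanged. When $|\vec o|$ reaches $0$, the algorithm switches to a new bishop phase. Potential: let $\ell^{opt},\ell^{on}$ be the distances traveled so far by an optimal offline server and the BR server, and $p^{opt},p^{on}$ their current positions (in the algorithm's current coordinate frame), with $y$ coordinates $p^{opt}_y,p^{on}_y$; let $h=p^{opt}_y-p^{on}_y$. Define $f=0$ if $h\le 0$, $f=(6-2\sqrt3)h$ if $0\le h\le|\vec o|$, and $f=(6-2\sqrt3)|\vec o|$ if $|\vec o|\le h$. Then $\Phi=(3+2\sqrt3)\ell^{opt}-3\,d(p^{on}+\vec o,p^{opt})-\ell^{on}-|\vec o|+f$.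
   Formalization: In a bishop phase the offset is −s_x x at every moment, not only at its end (otherwise Φ can decrease). If server and request coincide at its start, it must end only when they meet after separating, with axes chosen so the request does not rise above the server (otherwise BR would stall). *)

theory Defs
  imports "HOL-Analysis.Analysis"
begin

type_synonym point = "real \<times> real"

definition l1_dist :: "point \<Rightarrow> point \<Rightarrow> real" where
  "l1_dist p q = \<bar>fst p - fst q\<bar> + \<bar>snd p - snd q\<bar>"

definition aligned :: "point \<Rightarrow> point \<Rightarrow> bool" where
  "aligned p q \<longleftrightarrow> fst p = fst q \<or> snd p = snd q"

text \<open>Lengths of curves are suprema of the lengths of inscribed polygons. The distance is a
  parameter because the metric of the product type is Euclidean, while costs are measured
  in the \<open>L\<^sub>1\<close> distance; with \<open>dist\<close> on the reals the same definition gives the total distance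
  travelled by a single coordinate. The supremum is meaningful only for rectifiable curves.\<close>

definition inscribed_lengths :: "('a \<Rightarrow> 'a \<Rightarrow> real) \<Rightarrow> (real \<Rightarrow> 'a) \<Rightarrow> real \<Rightarrow> real \<Rightarrow> real set" where
  "inscribed_lengths \<delta> g a b =
     {\<Sum>i<length ts - 1. \<delta> (g (ts ! i)) (g (ts ! Suc i)) | ts. sorted ts \<and> set ts \<subseteq> {a..b}}"

definition rectifiable :: "('a \<Rightarrow> 'a \<Rightarrow> real) \<Rightarrow> (real \<Rightarrow> 'a) \<Rightarrow> real \<Rightarrow> real \<Rightarrow> bool" where
  "rectifiable \<delta> g a b \<longleftrightarrow> bdd_above (inscribed_lengths \<delta> g a b)"

definition curve_length :: "('a \<Rightarrow> 'a \<Rightarrow> real) \<Rightarrow> (real \<Rightarrow> 'a) \<Rightarrow> real \<Rightarrow> real \<Rightarrow> real" where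
  "curve_length \<delta> g a b = Sup (inscribed_lengths \<delta> g a b)"


text \<open>An input is indexed from 0. Inputs are infinite sequences of which a prefix is considered:
  the request traverses the segment from \<open>p i\<close> to \<open>p (Suc i)\<close> during the time interval
  \<open>[i, i + 1]\<close>, and a finite input with final point \<open>p n\<close> corresponds to the time horizon \<open>n\<close>.\<close>

definition cnn_input :: "(nat \<Rightarrow> point) \<Rightarrow> (nat \<Rightarrow> point) \<Rightarrow> bool" where
  "cnn_input p d \<longleftrightarrow>
     p 0 = 0 \<and> (\<forall>i. norm (d i) = 1 \<and> (\<exists>t\<ge>0. p (Suc i) = p i + t *\<^sub>R d i))"

definition request :: "(nat \<Rightarrow> point) \<Rightarrow> real \<Rightarrow> point" where
  "request p t = (let i = nat \<lfloor>t\<rfloor> in p i + (t - real i) *\<^sub>R (p (Suc i) - p i))"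

definition feasible_server :: "(real \<Rightarrow> point) \<Rightarrow> real \<Rightarrow> (real \<Rightarrow> point) \<Rightarrow> bool" where
  "feasible_server r T q \<longleftrightarrow>
     continuous_on {0..T} q \<and> q 0 = 0 \<and> (\<forall>t\<in>{0..T}. aligned (q t) (r t)) \<and>
     rectifiable l1_dist q 0 T"

definition opt_cost :: "(real \<Rightarrow> point) \<Rightarrow> real \<Rightarrow> real" where
  "opt_cost r T = (INF q \<in> {q. feasible_server r T q}. curve_length l1_dist q 0 T)"

text \<open>A possibly nondeterministic algorithm is given by the set of server trajectories that it
  may produce on a request trajectory up to a time horizon.\<close>

definition competitive :: "((real \<Rightarrow> point) \<Rightarrow> real \<Rightarrow> (real \<Rightarrow> point) set) \<Rightarrow> real \<Rightarrow> bool" where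
  "competitive A c \<longleftrightarrow>
     (\<forall>p d n. cnn_input p d \<longrightarrow>
        A (request p) (real n) \<noteq> {} \<and>
        (\<forall>s \<in> A (request p) (real n).
           feasible_server (request p) (real n) s \<and>
           curve_length l1_dist s 0 (real n) \<le> c * opt_cost (request p) (real n)))"


text \<open>Redrawn axes are described by the unit vectors of their positive directions; the coordinates
  of a point \<open>z\<close> relative to an origin \<open>c\<close> are \<open>(z - c) \<bullet> ex\<close> and \<open>(z - c) \<bullet> ey\<close>.\<close>

definition axes :: "point \<Rightarrow> point \<Rightarrow> bool" where
  "axes ex ey \<longleftrightarrow>
     {ex, ey} \<subseteq> {(1, 0), (- 1, 0), (0, 1), (0, - 1)} \<and> ex \<bullet> ey = 0"

text \<open>A bishop phase during \<open>[a, b]\<close>, with the request at time \<open>a\<close> as origin. Three points need care.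

  The offset is maintained continuously: at every moment it is \<open>- s\<^sub>x\<close> times the unit
  vector \<open>ex\<close>, where \<open>s\<^sub>x\<close> is the current x coordinate of the server, so that it is 0 at
  the start and has the prescribed value at the end of the phase.

  The server never passes below the request. This is automatic if the phase starts with
  \<open>h > 0\<close>, and for \<open>h = 0\<close> it restricts the choice of the axes: as long as the phase lasts,
  the request must not get above the server.

  The phase ends when server and request coincide. If \<open>h = 0\<close> they coincide from the outset,
  and the phase could make no progress if this coincidence ended it. Therefore only
  a coincidence after the two have separated is required to end the phase; it may, but need not,
  be ended earlier while they still coincide.\<close>

definition bishop_phase ::
  "(real \<Rightarrow> point) \<Rightarrow> (real \<Rightarrow> point) \<Rightarrow> (real \<Rightarrow> point) \<Rightarrow> point \<Rightarrow> point \<Rightarrow> real \<Rightarrow> real \<Rightarrow> bool" where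
  "bishop_phase r s off ex ey a b \<longleftrightarrow>
     (\<forall>t\<in>{a..b}.
        s t \<bullet> ex = r t \<bullet> ex \<and>
        s t \<bullet> ey = s a \<bullet> ey - curve_length dist (\<lambda>u. r u \<bullet> ex) a t \<and>
        s t \<bullet> ey \<ge> r t \<bullet> ey \<and>
        off t = - (((s t - r a) \<bullet> ex) *\<^sub>R ex)) \<and>
     (\<forall>t\<in>{a<..<b}. s t = r t \<longrightarrow> (\<forall>u\<in>{a..t}. s u = r u))"

text \<open>In a rook phase the server moves vertically always, and horizontally only, together with
  the request. Hence the distances that they move together are the distances travelled by the two
  coordinates of the server.\<close>

definition rook_phase ::
  "(real \<Rightarrow> point) \<Rightarrow> (real \<Rightarrow> point) \<Rightarrow> (real \<Rightarrow> point) \<Rightarrow> point \<Rightarrow> point \<Rightarrow> real \<Rightarrow> real \<Rightarrow> bool" where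
  "rook_phase r s off ex ey a b \<longleftrightarrow>
     (\<forall>t\<in>{a..b}. s t \<bullet> ey = r t \<bullet> ey \<and> s t \<bullet> ex \<le> r t \<bullet> ex) \<and>
     (\<forall>u v. a \<le> u \<and> u \<le> v \<and> v \<le> b \<longrightarrow>
        ((\<forall>t\<in>{u<..<v}. s t \<bullet> ex < r t \<bullet> ex) \<longrightarrow> s v \<bullet> ex = s u \<bullet> ex) \<and>
        (mono_on {u..v} (\<lambda>t. r t \<bullet> ex) \<longrightarrow> s v \<bullet> ex = s u \<bullet> ex) \<and>
        (s u \<bullet> ex = r u \<bullet> ex \<and> antimono_on {u..v} (\<lambda>t. r t \<bullet> ex) \<longrightarrow> s v \<bullet> ex = r v \<bullet> ex)) \<and>
     (\<forall>t\<in>{a..b}.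
        off t = - (norm (off t) *\<^sub>R ex) \<and>
        norm (off t) = norm (off a)
          - (1 + sqrt 3) * curve_length dist (\<lambda>u. s u \<bullet> ey) a t
          - curve_length dist (\<lambda>u. s u \<bullet> ex) a t) \<and>
     (\<forall>t\<in>{a..<b}. off t \<noteq> 0)"

text \<open>Phase number \<open>k\<close> takes place during \<open>[times R k, times R (Suc k)]\<close> with the axes
  \<open>xaxis R k\<close> and \<open>yaxis R k\<close>.\<close>

record br_run =
  phases :: nat
  times :: "nat \<Rightarrow> real"
  xaxis :: "nat \<Rightarrow> point"
  yaxis :: "nat \<Rightarrow> point"
  server :: "real \<Rightarrow> point"
  offset :: "real \<Rightarrow> point"

text \<open>Even phases are bishop phases and odd phases are rook phases. The last phase may be cut off
  by the time horizon; for all others the condition for switching holds when they end.\<close>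

definition br_execution :: "(real \<Rightarrow> point) \<Rightarrow> real \<Rightarrow> br_run \<Rightarrow> bool" where
  "br_execution r T R \<longleftrightarrow>
     continuous_on {0..T} (server R) \<and> server R 0 = 0 \<and>
     0 < phases R \<and> times R 0 = 0 \<and> times R (phases R) = T \<and>
     (\<forall>k<phases R.
        times R k \<le> times R (Suc k) \<and>
        axes (xaxis R k) (yaxis R k) \<and>
        (if even k
         then bishop_phase r (server R) (offset R) (xaxis R k) (yaxis R k) (times R k) (times R (Suc k))
         else rook_phase r (server R) (offset R) (xaxis R k) (yaxis R k) (times R k) (times R (Suc k)))) \<and>
     (\<forall>k. Suc k < phases R \<longrightarrow>
        (if even k
         then server R (times R (Suc k)) = r (times R (Suc k)) \<and>
              yaxis R (Suc k) = yaxis R k \<and> xaxis R (Suc k) \<in> {xaxis R k, - xaxis R k}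
         else offset R (times R (Suc k)) = 0))"

definition bishop_rook :: "(real \<Rightarrow> point) \<Rightarrow> real \<Rightarrow> (real \<Rightarrow> point) set" where
  "bishop_rook r T = {server R | R. br_execution r T R}"


text \<open>At a time shared by several phases, the first of them is chosen; the choice is irrelevant for
  the potential, because the y axis is redrawn only when the offset is 0.\<close>

definition phase_at :: "br_run \<Rightarrow> real \<Rightarrow> nat" where
  "phase_at R t = (LEAST k. t \<le> times R (Suc k))"

definition offset_bonus :: "real \<Rightarrow> real \<Rightarrow> real" where
  "offset_bonus h w =
     (if h \<le> 0 then 0
      else if h \<le> w then (6 - 2 * sqrt 3) * h
      else (6 - 2 * sqrt 3) * w)"

definition potential :: "br_run \<Rightarrow> (real \<Rightarrow> point) \<Rightarrow> real \<Rightarrow> real" where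
  "potential R q t =
     (3 + 2 * sqrt 3) * curve_length l1_dist q 0 t
     - 3 * l1_dist (server R t + offset R t) (q t)
     - curve_length l1_dist (server R) 0 t
     - norm (offset R t)
     + offset_bonus ((q t - server R t) \<bullet> yaxis R (phase_at R t)) (norm (offset R t))"

end

theory Submission
  imports Defs
begin

text \<open>On a time interval during which both coordinates of the request are monotone, the change of
  the potential is determined by the values at the two ends, provided that the offline server is
  aligned with the request in the same coordinate at both ends. The claim is then an inequality
  between finitely many real numbers. An offline server that changes its alignment has to meet the
  request in between, where it is aligned in both coordinates, and the interval can be split there.
  So neither differentiation nor continuity of the potential is needed, although the offline
  server is only continuous and rectifiable.

  Competitiveness also requires that executions exist, that is, that finitely many phases suffice.
  They are constructed one segment of the input after the other. On a segment the request has
  constant velocity, and after boundedly many phases it recedes from the server too fast to be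
  caught in a bishop phase on that segment.\<close>

section \<open>Lengths of curves\<close>

text \<open>The constants solve three balance equations. Let \<open>c\<close> be the ratio, \<gamma>
  the rate at which vertical motion uses up the offset in a rook phase and \<beta> the slope of the
  bonus, and take moves of length 1. In a bishop phase, let the request move away from the phase
  origin while the offline server moves along horizontally, above the online server by at most the
  offset length. The online server pays 2, the offset 1 and the distance term 3 in either direction,
  so \<open>c + \<beta> = 9\<close>. In a rook phase, let the offline server rest straight above the
  request by more than the offset length while the request descends: this balances if (4 - \<beta>)
  \<gamma> = 4. In a rook phase, let the offline server be to the left of the shifted server and
  move vertically with the request: this balances if c = 1 + 2 \<gamma>. Eliminating c and \<beta>
  leaves \<gamma>^2 = 2 \<gamma> + 2, so \<gamma> = 1 + sqrt 3. During these moves the potential is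
  constant, so the estimates must not lose anything there.\<close>

locale length_metric =
  fixes \<delta> :: "'a \<Rightarrow> 'a \<Rightarrow> real"
  assumes self: "\<delta> x x = 0"
    and nonneg: "0 \<le> \<delta> x y"
    and triangle: "\<delta> x z \<le> \<delta> x y + \<delta> y z"
begin

definition polygon_length :: "(real \<Rightarrow> 'a) \<Rightarrow> real list \<Rightarrow> real" where
  "polygon_length g ts = (\<Sum>i<length ts - 1. \<delta> (g (ts ! i)) (g (ts ! Suc i)))"

lemma polygon_length_simps [simp]:
  "polygon_length g [] = 0"
  "polygon_length g [x] = 0"
  "polygon_length g (x # y # ts) = \<delta> (g x) (g y) + polygon_length g (y # ts)"
  by (simp_all add: polygon_length_def sum.lessThan_Suc_shift del: sum.lessThan_Suc)

lemma inscribed_lengths_eq: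
  "inscribed_lengths \<delta> g a b = {polygon_length g ts | ts. sorted ts \<and> set ts \<subseteq> {a..b}}"
  by (simp add: inscribed_lengths_def polygon_length_def)

lemma polygon_length_append:
  "polygon_length g (xs @ b # ys) = polygon_length g (xs @ [b]) + polygon_length g (b # ys)"
proof (induction xs)
  case (Cons x xs)
  then show ?case by (cases xs) auto
qed auto

lemma polygon_length_insert: "polygon_length g (xs @ ys) \<le> polygon_length g (xs @ b # ys)"
proof (induction xs)
  case Nil
  then show ?case by (cases ys) (auto simp: nonneg)
next
  case (Cons x xs)
  show ?case
  proof (cases xs)
    case Nil
    then show ?thesis using triangle[of "g x" "g (hd ys)" "g b"] nonneg[of "g x" "g b"]
      by (cases ys) auto
  next
    case (Cons y zs)
    then show ?thesis using Cons.IH by simp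
  qed
qed

lemma inscribed_lengths_nonempty: "inscribed_lengths \<delta> g a b \<noteq> {}"
  unfolding inscribed_lengths_eq by (auto intro: exI[of _ "[]"])

lemma rectifiable_subinterval:
  assumes "rectifiable \<delta> g a b" "a \<le> a'" "b' \<le> b"
  shows "rectifiable \<delta> g a' b'"
proof -
  have "inscribed_lengths \<delta> g a' b' \<subseteq> inscribed_lengths \<delta> g a b"
    using assms(2,3) unfolding inscribed_lengths_eq by fastforce
  then show ?thesis using assms(1) unfolding rectifiable_def by (meson bdd_above_mono)
qed

lemma polygon_length_le_curve_length:
  assumes "rectifiable \<delta> g a b" "sorted ts" "set ts \<subseteq> {a..b}"
  shows "polygon_length g ts \<le> curve_length \<delta> g a b"
  using assms unfolding rectifiable_def curve_length_def inscribed_lengths_eq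
  by (intro cSup_upper) auto

lemma curve_length_least:
  assumes "\<And>ts. sorted ts \<Longrightarrow> set ts \<subseteq> {a..b} \<Longrightarrow> polygon_length g ts \<le> M"
  shows "curve_length \<delta> g a b \<le> M" "rectifiable \<delta> g a b"
proof -
  have le: "x \<le> M" if "x \<in> inscribed_lengths \<delta> g a b" for x
    using assms that unfolding inscribed_lengths_eq by auto
  show "curve_length \<delta> g a b \<le> M"
    unfolding curve_length_def by (rule cSup_least[OF inscribed_lengths_nonempty le])
  show "rectifiable \<delta> g a b"
    unfolding rectifiable_def by (rule bdd_aboveI[OF le])
qed

text \<open>Inserting the vertex \<open>b\<close> never shortens a polygon, and a polygon through
  \<open>b\<close> splits there into two. This bounds the polygons on the whole interval. For the
  converse, polygons on the two sides are joined at \<open>b\<close>, and the two suprema are taken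
  one after the other.\<close>

lemma
  assumes "a \<le> b" "b \<le> c" and r1: "rectifiable \<delta> g a b" and r2: "rectifiable \<delta> g b c"
  shows rectifiable_append: "rectifiable \<delta> g a c"
    and curve_length_append:
      "curve_length \<delta> g a c = curve_length \<delta> g a b + curve_length \<delta> g b c"
proof -
  have le: "polygon_length g ts \<le> curve_length \<delta> g a b + curve_length \<delta> g b c"
    if ts: "sorted ts" "set ts \<subseteq> {a..c}" for ts
  proof -
    define xs where "xs = takeWhile (\<lambda>t. t \<le> b) ts"
    define ys where "ys = dropWhile (\<lambda>t. t \<le> b) ts"
    have split: "ts = xs @ ys" by (simp add: xs_def ys_def)
    have "\<forall>x\<in>set xs. x \<le> b" by (auto simp: xs_def dest: set_takeWhileD)
    moreover have sorted: "sorted (xs @ ys)" "set (xs @ ys) \<subseteq> {a..c}" using ts split by simp_all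
    ultimately have xs: "set xs \<subseteq> {a..b}" "sorted (xs @ [b])"
      by (auto simp: sorted_append)
    have ys0: "\<forall>y\<in>set ys. b \<le> y"
    proof (cases ys)
      case (Cons y zs)
      then have "\<not> y \<le> b" using hd_dropWhile[of "\<lambda>t. t \<le> b" ts] by (auto simp: ys_def)
      moreover have "sorted (y # zs)" using sorted(1) Cons by (simp add: sorted_append)
      ultimately show ?thesis using Cons by fastforce
    qed simp
    have ys: "set ys \<subseteq> {b..c}" "sorted (b # ys)"
      using sorted ys0 by (auto simp: sorted_append)
    have "polygon_length g ts \<le> polygon_length g (xs @ b # ys)"
      unfolding split by (rule polygon_length_insert)
    also have "\<dots> = polygon_length g (xs @ [b]) + polygon_length g (b # ys)"
      by (rule polygon_length_append)
    also have "\<dots> \<le> curve_length \<delta> g a b + curve_length \<delta> g b c"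
      using xs ys assms by (intro add_mono polygon_length_le_curve_length) auto
    finally show ?thesis .
  qed
  show rect: "rectifiable \<delta> g a c" by (rule curve_length_least(2)[OF le])
  have "curve_length \<delta> g a b \<le> curve_length \<delta> g a c - curve_length \<delta> g b c"
  proof (rule curve_length_least)
    fix xs assume xs: "sorted xs" "set xs \<subseteq> {a..b}"
    have "curve_length \<delta> g b c \<le> curve_length \<delta> g a c - polygon_length g xs"
    proof (rule curve_length_least)
      fix ys assume ys: "sorted ys" "set ys \<subseteq> {b..c}"
      have "polygon_length g xs + polygon_length g ys
          \<le> polygon_length g (xs @ b # []) + polygon_length g ([] @ b # ys)"
        using polygon_length_insert[of g xs "[]" b] polygon_length_insert[of g "[]" ys b] by simp
      also have "\<dots> = polygon_length g (xs @ b # ys)"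
        using polygon_length_append[of g xs b ys] by simp
      also have "\<dots> \<le> curve_length \<delta> g a c"
        using xs ys assms by (intro polygon_length_le_curve_length rect) (force simp: sorted_append)+
      finally show "polygon_length g ys \<le> curve_length \<delta> g a c - polygon_length g xs" by simp
    qed
    then show "polygon_length g xs \<le> curve_length \<delta> g a c - curve_length \<delta> g b c" by simp
  qed
  moreover have "curve_length \<delta> g a c \<le> curve_length \<delta> g a b + curve_length \<delta> g b c"
    by (rule curve_length_least(1)[OF le])
  ultimately show "curve_length \<delta> g a c = curve_length \<delta> g a b + curve_length \<delta> g b c" by simp
qed

lemma dist_le_curve_length:
  assumes "rectifiable \<delta> g a b" "a \<le> b"
  shows "\<delta> (g a) (g b) \<le> curve_length \<delta> g a b"
  using polygon_length_le_curve_length[OF assms(1), of "[a, b]"] assms(2) by simp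

text \<open>Equality in the triangle inequality along the curve. It makes the length a function of
  the two ends, which is how curve lengths disappear from the estimates.\<close>

definition geodesic :: "(real \<Rightarrow> 'a) \<Rightarrow> real \<Rightarrow> real \<Rightarrow> bool" where
  "geodesic g a b \<longleftrightarrow>
     (\<forall>u v w. a \<le> u \<and> u \<le> v \<and> v \<le> w \<and> w \<le> b \<longrightarrow> \<delta> (g u) (g w) = \<delta> (g u) (g v) + \<delta> (g v) (g w))"

lemma
  assumes "geodesic g a b" "a \<le> b"
  shows geodesic_rectifiable: "rectifiable \<delta> g a b"
    and geodesic_curve_length: "curve_length \<delta> g a b = \<delta> (g a) (g b)"
proof -
  have add: "\<delta> (g u) (g w) = \<delta> (g u) (g v) + \<delta> (g v) (g w)"
    if "a \<le> u" "u \<le> v" "v \<le> w" "w \<le> b" for u v w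
    using assms that unfolding geodesic_def by blast
  \<comment> \<open>The polygon is compared with the chord from its first vertex to \<open>b\<close>
    rather than to its last vertex, so that removing the first vertex leaves an instance of the same
    claim.\<close>
  have aux: "sorted (x # ts) \<Longrightarrow> set (x # ts) \<subseteq> {a..b} \<Longrightarrow> polygon_length g (x # ts) \<le> \<delta> (g x) (g b)"
    for x ts
  proof (induction ts arbitrary: x)
    case (Cons y ts)
    then show ?case using add[of x y b] by fastforce
  qed (simp add: nonneg)
  have le: "polygon_length g ts \<le> \<delta> (g a) (g b)" if "sorted ts" "set ts \<subseteq> {a..b}" for ts
  proof (cases ts)
    case (Cons x xs)
    then have "a \<le> x" "x \<le> b" using that by auto
    then show ?thesis using aux[of x xs] that add[of a x b] nonneg[of "g a" "g x"] Cons by auto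
  qed (simp add: nonneg)
  show "rectifiable \<delta> g a b" by (rule curve_length_least(2)[OF le])
  then show "curve_length \<delta> g a b = \<delta> (g a) (g b)"
    using curve_length_least(1)[OF le] dist_le_curve_length assms(2) by (meson order_antisym)
qed

lemma curve_length_cong:
  assumes "\<And>t. t \<in> {a..b} \<Longrightarrow> g t = g' t"
  shows "curve_length \<delta> g a b = curve_length \<delta> g' a b"
proof -
  have "polygon_length g ts = polygon_length g' ts" if "set ts \<subseteq> {a..b}" for ts
    unfolding polygon_length_def
  proof (rule sum.cong)
    fix i assume "i \<in> {..<length ts - 1}"
    then have "ts ! i \<in> set ts" "ts ! Suc i \<in> set ts" by auto
    then show "\<delta> (g (ts ! i)) (g (ts ! Suc i)) = \<delta> (g' (ts ! i)) (g' (ts ! Suc i))"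
      using that assms by (metis subsetD)
  qed simp
  then have "inscribed_lengths \<delta> g a b = inscribed_lengths \<delta> g' a b"
    unfolding inscribed_lengths_eq by (auto, metis+)
  then show ?thesis unfolding curve_length_def by simp
qed

lemma curve_length_refl [simp]: "curve_length \<delta> g a a = 0"
proof -
  have "geodesic g a a" unfolding geodesic_def
    by (metis add_0 order_antisym order_trans self)
  then show ?thesis by (simp add: geodesic_curve_length self)
qed

end

interpretation dist_length: length_metric "dist :: real \<Rightarrow> real \<Rightarrow> real"
  by unfold_locales (auto simp: dist_triangle)

interpretation l1_length: length_metric l1_dist
  by unfold_locales (auto simp: l1_dist_def)

abbreviation monotone_fun :: "(real \<Rightarrow> real) \<Rightarrow> real \<Rightarrow> real \<Rightarrow> bool" where
  "monotone_fun g a b \<equiv> mono_on {a..b} g \<or> antimono_on {a..b} g"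

lemma monotone_fun_geodesic:
  assumes "monotone_fun g a b"
  shows "dist_length.geodesic g a b"
proof -
  have "\<bar>g u - g w\<bar> = \<bar>g u - g v\<bar> + \<bar>g v - g w\<bar>" if "a \<le> u" "u \<le> v" "v \<le> w" "w \<le> b" for u v w
  proof -
    have m: "u \<in> {a..b}" "v \<in> {a..b}" "w \<in> {a..b}" using that by auto
    have "(g u \<le> g v \<and> g v \<le> g w) \<or> (g u \<ge> g v \<and> g v \<ge> g w)"
      using assms that m unfolding monotone_on_def by blast
    then show ?thesis by linarith
  qed
  then show ?thesis unfolding dist_length.geodesic_def dist_real_def by blast
qed

section \<open>Axes\<close>

lemma axes_cases:
  assumes "axes ex ey"
  obtains "ex = (1, 0)" "ey = (0, 1)" | "ex = (1, 0)" "ey = (0, -1)"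
    | "ex = (-1, 0)" "ey = (0, 1)" | "ex = (-1, 0)" "ey = (0, -1)"
    | "ex = (0, 1)" "ey = (1, 0)" | "ex = (0, 1)" "ey = (-1, 0)"
    | "ex = (0, -1)" "ey = (1, 0)" | "ex = (0, -1)" "ey = (-1, 0)"
proof -
  have "ex \<in> {(1, 0), (- 1, 0), (0, 1), (0, - 1)}" "ey \<in> {(1, 0), (- 1, 0), (0, 1), (0, - 1)}"
    "ex \<bullet> ey = 0" using assms unfolding axes_def by auto
  then show ?thesis using that by (elim insertE emptyE) (simp_all add: inner_prod_def)
qed

lemma l1_dist_axes:
  assumes "axes ex ey"
  shows "l1_dist p q = \<bar>p \<bullet> ex - q \<bullet> ex\<bar> + \<bar>p \<bullet> ey - q \<bullet> ey\<bar>"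
  using assms by (cases rule: axes_cases) (auto simp: l1_dist_def inner_prod_def)

lemma aligned_axes:
  assumes "axes ex ey"
  shows "aligned p q \<longleftrightarrow> p \<bullet> ex = q \<bullet> ex \<or> p \<bullet> ey = q \<bullet> ey"
  using assms by (cases rule: axes_cases) (auto simp: aligned_def inner_prod_def)

lemma point_eq_axes:
  assumes "axes ex ey"
  shows "p = q \<longleftrightarrow> p \<bullet> ex = q \<bullet> ex \<and> p \<bullet> ey = q \<bullet> ey"
  using assms by (cases rule: axes_cases) (auto simp: prod_eq_iff inner_prod_def)

lemma axes_inner [simp]:
  assumes "axes ex ey"
  shows "ex \<bullet> ex = 1" "ey \<bullet> ey = 1" "ex \<bullet> ey = 0" "ey \<bullet> ex = 0" "norm ex = 1" "norm ey = 1"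
  using assms by (cases rule: axes_cases; simp add: inner_prod_def norm_Pair)+

lemma monotone_axes_geodesic:
  assumes ax: "axes ex ey"
    and "monotone_fun (\<lambda>t. g t \<bullet> ex) a b" "monotone_fun (\<lambda>t. g t \<bullet> ey) a b"
  shows "l1_length.geodesic g a b"
proof -
  have "\<bar>f u - f w\<bar> = \<bar>f u - f v\<bar> + \<bar>f v - f w\<bar>"
    if "dist_length.geodesic f a b" "a \<le> u" "u \<le> v" "v \<le> w" "w \<le> b" for f u v w
    using that unfolding dist_length.geodesic_def dist_real_def by blast
  note * = this[OF monotone_fun_geodesic[OF assms(2)]] this[OF monotone_fun_geodesic[OF assms(3)]]
  show ?thesis
    unfolding l1_length.geodesic_def l1_dist_axes[OF ax]
  proof (intro allI impI)
    fix u v w assume "a \<le> u \<and> u \<le> v \<and> v \<le> w \<and> w \<le> b"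
    then show "\<bar>g u \<bullet> ex - g w \<bullet> ex\<bar> + \<bar>g u \<bullet> ey - g w \<bullet> ey\<bar>
      = \<bar>g u \<bullet> ex - g v \<bullet> ex\<bar> + \<bar>g u \<bullet> ey - g v \<bullet> ey\<bar>
        + (\<bar>g v \<bullet> ex - g w \<bullet> ex\<bar> + \<bar>g v \<bullet> ey - g w \<bullet> ey\<bar>)"
      using *(1)[of u v w] *(2)[of u v w] by linarith
  qed
qed

section \<open>Estimates for a single step\<close>

text \<open>For the slope \<beta> = 6 - 2 sqrt 3 of the bonus, the two inequalities mean 2 < \<beta>
  \<le> 3.\<close>

lemma sqrt3_bounds: "sqrt 3 * sqrt 3 = (3 :: real)" "3 \<le> 2 * sqrt (3 :: real)" "sqrt (3 :: real) < 2"
  using real_le_rsqrt[of "3 / 2" 3] by (auto intro: real_less_lsqrt simp: power2_eq_square)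

text \<open>The part of the potential that depends on the height \<open>h\<close> of the offline
  server above the online one. The offset is horizontal, so \<open>h\<close> is also the vertical
  component of the distance term, which has weight 3.\<close>

definition vertical_gain :: "real \<Rightarrow> real \<Rightarrow> real" where
  "vertical_gain h w = offset_bonus h w - 3 * \<bar>h\<bar>"

lemma offset_bonus_eq:
  "0 \<le> w \<Longrightarrow> offset_bonus h w = (6 - 2 * sqrt 3) * max 0 (min h w)"
  by (auto simp: offset_bonus_def)

text \<open>As a function of \<open>h\<close> the gain is piecewise linear with slopes 3, \<beta> -
  3 and -3, where 0 \<le> \<beta> \<le> 6.\<close>

lemma vertical_gain_lipschitz:
  assumes "0 \<le> w"
  shows "vertical_gain h w - 3 * \<bar>h' - h\<bar> \<le> vertical_gain h' w"
proof -
  define \<beta> :: real where "\<beta> = 6 - 2 * sqrt 3"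
  define m m' where "m = max 0 (min h w)" and "m' = max 0 (min h' w)"
  have \<beta>: "0 \<le> \<beta>" "\<beta> \<le> 6" using sqrt3_bounds by (auto simp: \<beta>_def)
  have bonus: "offset_bonus h w = \<beta> * m" "offset_bonus h' w = \<beta> * m'"
    using assms by (auto simp: offset_bonus_eq \<beta>_def m_def m'_def)
  consider "h \<le> h'" | "h' < h" "h \<le> 0" | "h' < h" "0 < h" "0 \<le> h'" | "h' < h" "0 < h" "h' < 0"
    by linarith
  then have "\<beta> * m - 3 * \<bar>h\<bar> - 3 * \<bar>h' - h\<bar> \<le> \<beta> * m' - 3 * \<bar>h'\<bar>"
  proof cases
    case 1
    then have "\<beta> * m \<le> \<beta> * m'" using \<beta> by (intro mult_left_mono) (auto simp: m_def m'_def)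
    moreover have "\<bar>h'\<bar> \<le> \<bar>h\<bar> + \<bar>h' - h\<bar>" by linarith
    ultimately show ?thesis by simp
  next
    case 2
    then have "m = 0" "m' = 0" by (auto simp: m_def m'_def)
    then show ?thesis using 2 by simp
  next
    case 3
    then have "\<beta> * (m - m') \<le> 6 * (h - h')" using \<beta> assms
      by (intro mult_mono) (auto simp: m_def m'_def)
    then show ?thesis using 3 by (simp add: algebra_simps)
  next
    case 4
    then have "\<beta> * m \<le> 6 * h" "m' = 0" using \<beta> assms
      by (auto simp: m_def m'_def intro!: mult_mono)
    then show ?thesis using 4 by simp
  qed
  then show ?thesis by (simp add: vertical_gain_def bonus)
qed

lemma vertical_gain_shrink:
  assumes "0 \<le> w'" "w' \<le> w"
  shows "vertical_gain h w - (6 - 2 * sqrt 3) * (w - w') \<le> vertical_gain h w'"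
proof -
  have "(6 - 2 * sqrt 3) * (max 0 (min h w) - max 0 (min h w')) \<le> (6 - 2 * sqrt 3) * (w - w')"
    using sqrt3_bounds assms by (intro mult_left_mono) auto
  then show ?thesis using assms by (simp add: vertical_gain_def offset_bonus_eq algebra_simps)
qed

text \<open>The critical estimate for a bishop phase: the offline server follows the request
  horizontally over a distance \<open>D\<close>, the online server descends by \<open>D\<close>, and
  the offset length changes by \<open>e\<close>. The coefficient 4 collects the weight 3 of the
  horizontal distance to the phase origin, which here equals the offset length, and the weight 1 of
  the offset length itself. The coefficient \<open>1 + 2 * sqrt 3\<close> is the competitive ratio
  minus the 2 paid for the diagonal move. Equality holds for \<open>e = D\<close> and 0 \<le> h
  \<le> w.\<close>

lemma vertical_gain_diagonal:
  assumes "0 \<le> w" "0 \<le> w + e" "\<bar>e\<bar> \<le> D"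
  shows "vertical_gain h w + 4 * e - (1 + 2 * sqrt 3) * D \<le> vertical_gain (h + D) (w + e)"
proof -
  define \<beta> :: real where "\<beta> = 6 - 2 * sqrt 3"
  define m m' where "m = max 0 (min h w)" and "m' = max 0 (min (h + D) (w + e))"
  have \<beta>: "2 \<le> \<beta>" "\<beta> \<le> 6" "2 * sqrt 3 = 6 - \<beta>" using sqrt3_bounds by (auto simp: \<beta>_def)
  have bonus: "offset_bonus h w = \<beta> * m" "offset_bonus (h + D) (w + e) = \<beta> * m'"
    using assms by (auto simp: offset_bonus_eq \<beta>_def m_def m'_def)
  have "e \<le> D" using assms by linarith
  \<comment> \<open>As 4 - \<beta> is nonnegative, \<open>e = D\<close> is the worst case.\<close>
  have "\<beta> \<le> 4" using sqrt3_bounds by (simp add: \<beta>_def)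
  then have eD: "(4 - \<beta>) * e \<le> (4 - \<beta>) * D" using \<open>e \<le> D\<close> by (intro mult_left_mono) auto
  consider "0 \<le> h" | "h + D \<le> 0" | "h < 0" "0 < h + D" by linarith
  then have "\<beta> * m - 3 * \<bar>h\<bar> + 4 * e - (7 - \<beta>) * D \<le> \<beta> * m' - 3 * \<bar>h + D\<bar>"
  proof cases
    case 1
    \<comment> \<open>Both arguments of the minimum grow by at least \<open>e\<close>.\<close>
    then have "m + e \<le> m'" using assms by (auto simp: m_def m'_def)
    then have "\<beta> * (m + e) \<le> \<beta> * m'" using \<beta> by (intro mult_left_mono) auto
    then show ?thesis using 1 assms eD by (simp add: algebra_simps)
  next
    case 2
    then have "m = 0" "m' = 0" using assms by (auto simp: m_def m'_def)
    moreover have "\<beta> * D \<le> 6 * D" using \<beta> assms by (intro mult_right_mono) auto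
    ultimately show ?thesis using 2 \<open>e \<le> D\<close> assms by (simp add: algebra_simps)
  next
    case 3
    have "m = 0" using 3 assms by (auto simp: m_def)
    have "e + h \<le> m'" using 3 assms by (auto simp: m'_def)
    then have "\<beta> * (e + h) \<le> \<beta> * m'" using \<beta> by (intro mult_left_mono) auto
    moreover have "6 * h \<le> \<beta> * h" using \<beta> 3 by (intro mult_right_mono_neg) auto
    moreover have "\<bar>h\<bar> = - h" "\<bar>h + D\<bar> = h + D" "\<beta> * m = 0" using 3 \<open>m = 0\<close> by auto
    ultimately show ?thesis using eD unfolding ring_distribs by argo
  qed
  moreover have "(1 + 2 * sqrt 3) * D = (7 - \<beta>) * D" using \<beta>(3) by simp
  ultimately show ?thesis unfolding vertical_gain_def bonus by argo
qed

text \<open>Throughout the two step lemmas, unprimed variables are coordinates before a step and primed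
  ones after it: \<open>q\<close> is the offline server, \<open>r\<close> the request, \<open>s\<close> the online server,
  \<open>w\<close> the length of the offset and \<open>x0\<close> the x coordinate of the origin of a bishop phase.\<close>

lemma bishop_step:
  fixes rx rx' ry ry' sy sy' qx qx' qy qy' x0 :: real
  defines "D \<equiv> \<bar>rx' - rx\<bar>"
  assumes sy': "sy' = sy - D" and above: "ry \<le> sy" "ry' \<le> sy'"
    and q: "qx = rx \<and> qx' = rx' \<or> qy = ry \<and> qy' = ry'"
  shows "- 3 * \<bar>x0 - qx\<bar> - \<bar>rx - x0\<bar> + vertical_gain (qy - sy) \<bar>rx - x0\<bar>
    \<le> (3 + 2 * sqrt 3) * (\<bar>qx - qx'\<bar> + \<bar>qy - qy'\<bar>) - 2 * D
      - 3 * \<bar>x0 - qx'\<bar> - \<bar>rx' - x0\<bar> + vertical_gain (qy' - sy') \<bar>rx' - x0\<bar>"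
  using q
proof (elim disjE conjE)
  assume q: "qx = rx" "qx' = rx'"
  define w e where "w = \<bar>rx - x0\<bar>" and "e = \<bar>rx' - x0\<bar> - \<bar>rx - x0\<bar>"
  have w': "\<bar>rx' - x0\<bar> = w + e" by (simp add: w_def e_def)
  have e: "\<bar>e\<bar> \<le> D" by (auto simp: e_def D_def)
  \<comment> \<open>The offline move is decomposed: its horizontal part, forced by the request,
    falls under the diagonal estimate, and its vertical part is paid for by the Lipschitz
    bound.\<close>
  have "vertical_gain (qy - sy) w + 4 * e - (1 + 2 * sqrt 3) * D
      \<le> vertical_gain (qy - sy + D) (w + e)"
    by (rule vertical_gain_diagonal) (use e w' in \<open>auto simp: w_def\<close>)
  moreover have "vertical_gain (qy - sy + D) (w + e)
      - 3 * \<bar>(qy' - sy') - (qy - sy + D)\<bar> \<le> vertical_gain (qy' - sy') (w + e)"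
    by (rule vertical_gain_lipschitz) (use w' in \<open>auto simp: w_def\<close>)
  moreover have "\<bar>(qy' - sy') - (qy - sy + D)\<bar> = \<bar>qy - qy'\<bar>" by (simp add: sy')
  moreover have "3 * \<bar>qy - qy'\<bar> \<le> (3 + 2 * sqrt 3) * \<bar>qy - qy'\<bar>"
    by (intro mult_right_mono) auto
  moreover have eqs: "\<bar>x0 - qx\<bar> = w" "\<bar>x0 - qx'\<bar> = w + e" "\<bar>rx - x0\<bar> = w" "\<bar>qx - qx'\<bar> = D"
    using q w' by (auto simp: w_def D_def abs_minus_commute)
  ultimately show ?thesis unfolding w' eqs ring_distribs by argo
next
  assume q: "qy = ry" "qy' = ry'"
  \<comment> \<open>Level with the request, the offline server is never above the online one, so
    there is no bonus. The online descent by \<open>D\<close> gains 3 D in the distance term, which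
    covers the travelled 2 D and the growth of the offset by at most \<open>D\<close>.\<close>
  have "qy - sy \<le> 0" "qy' - sy' \<le> 0" using q above by auto
  then have gain: "vertical_gain (qy - sy) w = 3 * (qy - sy)"
    "vertical_gain (qy' - sy') w = 3 * (qy' - sy')" for w
    by (auto simp: vertical_gain_def offset_bonus_def)
  have "3 * (\<bar>qx - qx'\<bar> + \<bar>qy - qy'\<bar>) \<le> (3 + 2 * sqrt 3) * (\<bar>qx - qx'\<bar> + \<bar>qy - qy'\<bar>)"
    by (intro mult_right_mono) auto
  moreover have "\<bar>x0 - qx'\<bar> \<le> \<bar>x0 - qx\<bar> + \<bar>qx - qx'\<bar>" "qy - qy' \<le> \<bar>qy - qy'\<bar>"
    "\<bar>rx' - x0\<bar> \<le> \<bar>rx - x0\<bar> + \<bar>rx' - rx\<bar>" by linarith+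
  ultimately show ?thesis unfolding gain unfolding sy' D_def by argo
qed

text \<open>Horizontal motion together with the request leaves \<open>sx - w\<close>, the x
  coordinate of the shifted server, unchanged, because the offset shrinks by the same distance. Only
  vertical motion moves the shifted server sideways, to the right by
  \<open>(1 + sqrt 3) * D\<close>.\<close>

lemma rook_step:
  fixes rx rx' ry ry' sx sx' qx qx' qy qy' w w' :: real
  defines "D \<equiv> \<bar>ry' - ry\<bar>"
  assumes w: "0 \<le> w" "0 \<le> w'" "w' = w - (1 + sqrt 3) * D - (sx - sx')"
    and left: "sx \<le> rx" "sx' \<le> rx'"
    and sx': "sx' \<le> sx" "sx - sx' \<le> max 0 (rx - rx')"
    and q: "qx = rx \<and> qx' = rx' \<or> qy = ry \<and> qy' = ry'"
  shows "- 3 * \<bar>sx - w - qx\<bar> - w + vertical_gain (qy - ry) w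
    \<le> (3 + 2 * sqrt 3) * (\<bar>qx - qx'\<bar> + \<bar>qy - qy'\<bar>) - (D + (sx - sx'))
      - 3 * \<bar>sx' - w' - qx'\<bar> - w' + vertical_gain (qy' - ry') w'"
  using q
proof (elim disjE conjE)
  define E where "E = sx - sx'"
  assume q: "qx = rx" "qx' = rx'"
  have D: "0 \<le> D" "0 \<le> sqrt 3 * D" by (simp_all add: D_def)
  have "w' \<le> w" using w(3) sx'(1) D unfolding ring_distribs by linarith
  have "vertical_gain (qy - ry) w - (6 - 2 * sqrt 3) * (w - w') \<le> vertical_gain (qy - ry) w'"
    by (rule vertical_gain_shrink[OF w(2) \<open>w' \<le> w\<close>])
  \<comment> \<open>Since \<open>(6 - 2 * sqrt 3) * (1 + sqrt 3) = 4 * sqrt 3\<close>, vertical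
    motion loses a bonus of at most 4 (1 + sqrt 3) D - 4 D. The shrinking offset yields 4 (1 + sqrt
    3) D, and the difference 4 D pays for the travel \<open>D\<close> and for the vertical distance,
    which has weight 3.\<close>
  moreover have "(6 - 2 * sqrt 3) * (w - w') = 4 * (sqrt 3 * D) + (6 - 2 * sqrt 3) * E"
    using sqrt3_bounds(1) by (simp add: w(3) E_def algebra_simps)
  moreover have "vertical_gain (qy - ry) w' - 3 * \<bar>(qy' - ry') - (qy - ry)\<bar>
      \<le> vertical_gain (qy' - ry') w'"
    by (rule vertical_gain_lipschitz[OF w(2)])
  moreover have "\<bar>(qy' - ry') - (qy - ry)\<bar> \<le> \<bar>qy - qy'\<bar> + D" by (simp add: D_def)
  moreover have "\<bar>sx - w - qx\<bar> = rx - sx + w" "\<bar>sx' - w' - qx'\<bar> = rx' - sx' + w'"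
    using q left w by auto
  moreover have "3 * \<bar>qy - qy'\<bar> \<le> (3 + 2 * sqrt 3) * \<bar>qy - qy'\<bar>"
    by (intro mult_right_mono) auto
  \<comment> \<open>The common horizontal motion \<open>E\<close> costs what the shrinking offset
    returns, so it enters only through the lost bonus. It is nonzero only if the request, and with
    it the offline server, moves left at least as far.\<close>
  moreover have "(6 - 2 * sqrt 3) * E + 3 * (rx' - rx) \<le> (3 + 2 * sqrt 3) * \<bar>qx - qx'\<bar>"
  proof (cases "rx \<le> rx'")
    case True
    then have "E = 0" using sx' by (simp add: E_def)
    then show ?thesis using q True by (simp add: algebra_simps)
  next
    case False
    then have "(6 - 2 * sqrt 3) * E \<le> 6 * (rx - rx')"
      using sx' sqrt3_bounds by (intro mult_mono) (auto simp: E_def)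
    moreover have "3 * (rx - rx') \<le> (3 + 2 * sqrt 3) * (rx - rx')"
      using False by (intro mult_right_mono) auto
    ultimately show ?thesis using q False by simp
  qed
  ultimately show ?thesis using w(3) D unfolding ring_distribs E_def by argo
next
  assume q: "qy = ry" "qy' = ry'"
  have "vertical_gain (qy - ry) w = 0" "vertical_gain (qy' - ry') w' = 0"
    using q by (auto simp: vertical_gain_def offset_bonus_def)
  \<comment> \<open>The offline server has to take part in the vertical move \<open>D\<close>. Its
    budget 3 + 2 sqrt 3 per unit is spent exactly: 1 on travel and 3 (1 + sqrt 3) on the shifted
    server moving away, less the 1 + sqrt 3 returned by the shorter offset.\<close>
  moreover have "\<bar>sx' - w' - qx'\<bar> \<le> \<bar>sx - w - qx\<bar> + \<bar>qx - qx'\<bar> + (1 + sqrt 3) * D"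
  proof -
    have "sx' - w' = sx - w + (1 + sqrt 3) * D" using w(3) by simp
    moreover have "0 \<le> (1 + sqrt 3) * D" by (simp add: D_def)
    ultimately show ?thesis by linarith
  qed
  moreover have "3 * \<bar>qx - qx'\<bar> \<le> (3 + 2 * sqrt 3) * \<bar>qx - qx'\<bar>"
    by (intro mult_right_mono) auto
  moreover have Dq: "\<bar>qy - qy'\<bar> = D" using q by (simp add: D_def)
  ultimately show ?thesis using w(3) unfolding Dq ring_distribs by argo
qed

section \<open>Requests that are affine on unit intervals\<close>

text \<open>The form in which the input enters the analysis. Each piece includes both of its ends,
  so that neighbouring pieces share the integer times.\<close>

definition unit_affine :: "(real \<Rightarrow> point) \<Rightarrow> bool" where
  "unit_affine r \<longleftrightarrow>
     (\<forall>i::nat. \<exists>v. \<forall>t\<in>{real i..real i + 1}. r t = r (real i) + (t - real i) *\<^sub>R v)"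

definition unit_step :: "real \<Rightarrow> real \<Rightarrow> bool" where
  "unit_step u v \<longleftrightarrow> (\<exists>i::nat. real i \<le> u \<and> u \<le> v \<and> v \<le> real i + 1)"

lemma unit_affine_request: "unit_affine (request p)"
  unfolding unit_affine_def
proof (intro allI exI ballI)
  fix i :: nat and t :: real assume t: "t \<in> {real i..real i + 1}"
  have eq: "request p t = p i + (t - real i) *\<^sub>R (p (Suc i) - p i)" if "t \<in> {real i..real i + 1}" for t
  proof (cases "t = real i + 1")
    \<comment> \<open>At the right end the floor selects the next segment, which starts at the same
      point.\<close>
    case True
    then have "nat \<lfloor>t\<rfloor> = Suc i" by linarith
    then show ?thesis using True by (simp add: request_def)
  next
    case False
    then have "nat \<lfloor>t\<rfloor> = i" using that by (auto simp: nat_eq_iff floor_eq_iff)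
    then show ?thesis by (simp add: request_def)
  qed
  show "request p t = request p (real i) + (t - real i) *\<^sub>R (p (Suc i) - p i)"
    using eq[OF t] eq[of "real i"] by simp
qed

text \<open>The interval is cut at the integers. \<open>P\<close> may be any relation between two
  times that combines along adjacent intervals, such as rectifiability or an inequality between
  values of the potential.\<close>

lemma unit_step_induct [consumes 2, case_names step trans]:
  assumes "0 \<le> a" "a \<le> b"
    and step: "\<And>u v. a \<le> u \<Longrightarrow> v \<le> b \<Longrightarrow> unit_step u v \<Longrightarrow> P u v"
    and trans: "\<And>u v w. a \<le> u \<Longrightarrow> u \<le> v \<Longrightarrow> v \<le> w \<Longrightarrow> w \<le> b \<Longrightarrow> P u v \<Longrightarrow> P v w \<Longrightarrow> P u w"
  shows "P a b"
proof -
  have "P a t" if "a \<le> t" "t \<le> b" "t \<le> real m" for m t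
    using that
  proof (induction m arbitrary: t)
    case 0
    then have "unit_step a t" using assms unfolding unit_step_def by (intro exI[of _ 0]) auto
    then show ?case using step 0 by blast
  next
    case (Suc m)
    show ?case
    proof (cases "real m \<le> a")
      case True
      then have "unit_step a t" using Suc.prems unfolding unit_step_def by (intro exI[of _ m]) auto
      then show ?thesis using step Suc.prems by blast
    next
      case False
      show ?thesis
      proof (cases "t \<le> real m")
        case True
        then show ?thesis using Suc by blast
      next
        case t: False
        then have "unit_step (real m) t"
          using Suc.prems unfolding unit_step_def by (intro exI[of _ m]) auto
        then have "P (real m) t" using step False Suc.prems by simp
        moreover have "P a (real m)" using Suc.IH[of "real m"] Suc.prems t False by simp
        ultimately show ?thesis using trans[of a "real m" t] Suc.prems t False by simp
      qed
    qed
  qed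
  moreover obtain m :: nat where "b \<le> real m" using real_arch_simple by blast
  ultimately show ?thesis using assms by blast
qed

lemma unit_step_le: "unit_step u v \<Longrightarrow> u \<le> v"
  by (auto simp: unit_step_def)

lemma unit_step_sub: "unit_step u v \<Longrightarrow> u \<le> u' \<Longrightarrow> u' \<le> v' \<Longrightarrow> v' \<le> v \<Longrightarrow> unit_step u' v'"
  unfolding unit_step_def by (elim ex_forward) linarith

lemma unit_affine_step:
  assumes "unit_affine r" "unit_step u v"
  obtains d where "\<And>t. t \<in> {u..v} \<Longrightarrow> r t = r u + (t - u) *\<^sub>R d"
proof -
  obtain i :: nat where i: "real i \<le> u" "u \<le> v" "v \<le> real i + 1"
    using assms(2) unfolding unit_step_def by blast
  obtain d where d: "\<And>t. t \<in> {real i..real i + 1} \<Longrightarrow> r t = r (real i) + (t - real i) *\<^sub>R d"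
    using assms(1) unfolding unit_affine_def by blast
  have "r t = r u + (t - u) *\<^sub>R d" if "t \<in> {u..v}" for t
  proof -
    have rt: "r t = r (real i) + (t - real i) *\<^sub>R d" and ru: "r u = r (real i) + (u - real i) *\<^sub>R d"
      using i that by (auto intro!: d)
    show ?thesis unfolding rt ru by (simp add: scaleR_left_distrib[symmetric])
  qed
  then show ?thesis using that by blast
qed

lemma unit_affine_monotone:
  assumes "unit_affine r" "unit_step u v"
  shows "monotone_fun (\<lambda>t. r t \<bullet> e) u v"
proof -
  obtain d where d: "\<And>t. t \<in> {u..v} \<Longrightarrow> r t = r u + (t - u) *\<^sub>R d"
    using unit_affine_step[OF assms] by blast
  have *: "r t \<bullet> e = r u \<bullet> e + (t - u) * (d \<bullet> e)" if "t \<in> {u..v}" for t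
    by (subst d[OF that]) (simp add: inner_add_left)
  have diff: "r y \<bullet> e - r x \<bullet> e = (y - x) * (d \<bullet> e)" if "x \<in> {u..v}" "y \<in> {u..v}" for x y
    using *[OF that(1)] *[OF that(2)] by (simp add: algebra_simps)
  show ?thesis
  proof (cases "0 \<le> d \<bullet> e")
    case True
    have "mono_on {u..v} (\<lambda>t. r t \<bullet> e)"
    proof (rule monotone_onI)
      fix x y assume "x \<in> {u..v}" "y \<in> {u..v}" "x \<le> y"
      then show "r x \<bullet> e \<le> r y \<bullet> e" using diff[of x y] True by (smt (verit) mult_nonneg_nonneg)
    qed
    then show ?thesis by blast
  next
    case False
    have "antimono_on {u..v} (\<lambda>t. r t \<bullet> e)"
    proof (rule monotone_onI)
      fix x y assume "x \<in> {u..v}" "y \<in> {u..v}" "x \<le> y"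
      then show "r y \<bullet> e \<le> r x \<bullet> e"
        using diff[of x y] False by (smt (verit) mult_nonneg_nonpos)
    qed
    then show ?thesis by blast
  qed
qed

lemma unit_affine_continuous:
  assumes "unit_affine r" "unit_step u v"
  shows "continuous_on {u..v} r"
proof -
  obtain d where d: "\<And>t. t \<in> {u..v} \<Longrightarrow> r t = r u + (t - u) *\<^sub>R d"
    using unit_affine_step[OF assms] by blast
  then show ?thesis
    by (subst continuous_on_cong[OF refl d]) (auto intro!: continuous_intros)
qed

text \<open>Lengths add up only where the curve is rectifiable, since the supremum of an unbounded
  set carries no information. So rectifiability on \<open>{a..b}\<close> is first assembled from the
  monotone pieces.\<close>

lemma piecewise_monotone_curve_length:
  assumes "0 \<le> a" "a \<le> b"
    and mono: "\<And>u v. a \<le> u \<Longrightarrow> v \<le> b \<Longrightarrow> unit_step u v \<Longrightarrow> monotone_fun f u v"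
    and uv: "a \<le> u" "v \<le> b" "unit_step u v"
  shows "curve_length dist f a v = curve_length dist f a u + \<bar>f v - f u\<bar>"
proof -
  have step: "rectifiable dist f u v \<and> curve_length dist f u v = \<bar>f v - f u\<bar>"
    if "a \<le> u" "v \<le> b" "unit_step u v" for u v
    using dist_length.geodesic_rectifiable dist_length.geodesic_curve_length
      monotone_fun_geodesic[OF mono[OF that]] unit_step_le[OF that(3)]
    by (metis abs_minus_commute dist_real_def)
  have rect: "rectifiable dist f a b"
    using assms(1,2)
  proof (induction rule: unit_step_induct)
    case (trans u v w)
    then show ?case using dist_length.rectifiable_append by blast
  qed (use step in blast)
  then show ?thesis
    using dist_length.curve_length_append[of a u v f] step[OF uv] uv
      dist_length.rectifiable_subinterval[OF rect, of a u] unit_step_le[OF uv(3)] by simp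
qed

section \<open>The phases of the algorithm\<close>

lemma bishop_phaseD:
  assumes "bishop_phase r s off ex ey a b" "t \<in> {a..b}"
  shows "s t \<bullet> ex = r t \<bullet> ex"
    "s t \<bullet> ey = s a \<bullet> ey - curve_length dist (\<lambda>u. r u \<bullet> ex) a t"
    "r t \<bullet> ey \<le> s t \<bullet> ey" "off t = - (((s t - r a) \<bullet> ex) *\<^sub>R ex)"
  using assms unfolding bishop_phase_def by blast+

lemma rook_phaseD:
  assumes "rook_phase r s off ex ey a b" "t \<in> {a..b}"
  shows "s t \<bullet> ey = r t \<bullet> ey" "s t \<bullet> ex \<le> r t \<bullet> ex" "off t = - (norm (off t) *\<^sub>R ex)"
    "norm (off t) = norm (off a) - (1 + sqrt 3) * curve_length dist (\<lambda>u. s u \<bullet> ey) a t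
      - curve_length dist (\<lambda>u. s u \<bullet> ex) a t"
  using assms unfolding rook_phase_def by blast+

lemma bishop_phase_step:
  assumes r: "unit_affine r" and ph: "bishop_phase r s off ex ey a b"
    and "0 \<le> a" "a \<le> u" "v \<le> b" "unit_step u v"
  shows "s v \<bullet> ey = s u \<bullet> ey - \<bar>r v \<bullet> ex - r u \<bullet> ex\<bar>"
proof -
  have uv: "u \<le> v" using assms unit_step_le by blast
  have "curve_length dist (\<lambda>t. r t \<bullet> ex) a v
      = curve_length dist (\<lambda>t. r t \<bullet> ex) a u + \<bar>r v \<bullet> ex - r u \<bullet> ex\<bar>"
    using assms(3-6) uv unit_affine_monotone[OF r] by (intro piecewise_monotone_curve_length) auto
  moreover have "u \<in> {a..b}" "v \<in> {a..b}" using uv assms(4,5) by auto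
  note this[THEN bishop_phaseD(2)[OF ph]]
  ultimately show ?thesis by linarith
qed

lemma bishop_phase_geodesic:
  assumes r: "unit_affine r" and ax: "axes ex ey" and ph: "bishop_phase r s off ex ey a b"
    and "0 \<le> a" "a \<le> u" "v \<le> b" "unit_step u v"
  shows "l1_length.geodesic s u v"
proof (rule monotone_axes_geodesic[OF ax])
  have "s t \<bullet> ex = r t \<bullet> ex" if "t \<in> {u..v}" for t
    using bishop_phaseD(1)[OF ph] that assms(5,6) by simp
  then show "monotone_fun (\<lambda>t. s t \<bullet> ex) u v"
    using unit_affine_monotone[OF r assms(7), of ex] by (simp add: monotone_on_def)
  have "antimono_on {u..v} (\<lambda>t. s t \<bullet> ey)"
  proof (rule monotone_onI)
    fix x y assume "x \<in> {u..v}" "y \<in> {u..v}" "x \<le> y"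
    then show "s y \<bullet> ey \<le> s x \<bullet> ey"
      using bishop_phase_step[OF r ph assms(4), of x y] unit_step_sub[OF assms(7), of x y] assms
      by simp
  qed
  then show "monotone_fun (\<lambda>t. s t \<bullet> ey) u v" by blast
qed

text \<open>No single rule of motion covers a request that moves left towards a server from which it
  is still apart and then meets it. The interval is cut at the first coincidence, which exists
  because server and request are continuous: before it the server rests, and after it the server
  moves with the request.\<close>

lemma rook_phase_step_x:
  assumes r: "unit_affine r" and ph: "rook_phase r s off ex ey a b"
    and s: "continuous_on {a..b} s"
    and "a \<le> u" "v \<le> b" and step: "unit_step u v"
  shows "s v \<bullet> ex \<le> s u \<bullet> ex" "s u \<bullet> ex - s v \<bullet> ex \<le> max 0 (r u \<bullet> ex - r v \<bullet> ex)"
proof -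
  have uv: "u \<le> v" using step unit_step_le by blast
  have left: "s t \<bullet> ex \<le> r t \<bullet> ex" if "t \<in> {u..v}" for t
    using rook_phaseD(2)[OF ph] that assms(4,5) by simp
  have moves: "(\<forall>t\<in>{x<..<y}. s t \<bullet> ex < r t \<bullet> ex) \<longrightarrow> s y \<bullet> ex = s x \<bullet> ex"
    "mono_on {x..y} (\<lambda>t. r t \<bullet> ex) \<longrightarrow> s y \<bullet> ex = s x \<bullet> ex"
    "s x \<bullet> ex = r x \<bullet> ex \<and> antimono_on {x..y} (\<lambda>t. r t \<bullet> ex) \<longrightarrow> s y \<bullet> ex = r y \<bullet> ex"
    if "u \<le> x" "x \<le> y" "y \<le> v" for x y
    using ph that assms(4,5) unfolding rook_phase_def by (meson order_trans)+
  have "s v \<bullet> ex \<le> s u \<bullet> ex \<and> s u \<bullet> ex - s v \<bullet> ex \<le> max 0 (r u \<bullet> ex - r v \<bullet> ex)"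
    using unit_affine_monotone[OF r step, of ex]
  proof
    assume "mono_on {u..v} (\<lambda>t. r t \<bullet> ex)"
    then show ?thesis using moves(2)[of u v] uv by simp
  next
    assume anti: "antimono_on {u..v} (\<lambda>t. r t \<bullet> ex)"
    define M where "M = {t \<in> {u..v}. (r t - s t) \<bullet> ex = 0}"
    show ?thesis
    proof (cases "M = {}")
      case True
      then have "\<forall>t\<in>{u<..<v}. s t \<bullet> ex < r t \<bullet> ex"
      proof (intro ballI)
        fix t assume t: "t \<in> {u<..<v}"
        then have "t \<notin> M" using True by simp
        then show "s t \<bullet> ex < r t \<bullet> ex" using left[of t] t by (auto simp: M_def inner_diff_left)
      qed
      then show ?thesis using moves(1)[of u v] uv by simp
    next
      case False
      have "continuous_on {u..v} s" using s assms(4,5) by (auto intro: continuous_on_subset)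
      then have "closed M" unfolding M_def
        by (intro continuous_closed_preimage_constant continuous_intros unit_affine_continuous[OF r step])
          auto
      moreover have bdd: "bdd_below M" by (auto simp: M_def intro!: bdd_belowI)
      ultimately have m: "Inf M \<in> M" using False closed_contains_Inf by blast
      define m where "m = Inf M"
      have m: "m \<in> M" "\<And>t. t \<in> M \<Longrightarrow> m \<le> t" using m bdd by (auto simp: m_def intro: cInf_lower)
      then have uv': "u \<le> m" "m \<le> v" and eq: "s m \<bullet> ex = r m \<bullet> ex"
        by (auto simp: M_def inner_diff_left)
      have "\<forall>t\<in>{u<..<m}. s t \<bullet> ex < r t \<bullet> ex"
      proof
        fix t assume t: "t \<in> {u<..<m}"
        then have "t \<notin> M" using m(2)[of t] by force
        then show "s t \<bullet> ex < r t \<bullet> ex" using left[of t] t uv' by (auto simp: M_def inner_diff_left)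
      qed
      then have "s m \<bullet> ex = s u \<bullet> ex" using moves(1)[of u m] uv' by simp
      moreover have "s v \<bullet> ex = r v \<bullet> ex"
        using moves(3)[of m v] uv' eq monotone_on_subset[OF anti, of "{m..v}"] by simp
      moreover have "r m \<bullet> ex \<le> r u \<bullet> ex" "r v \<bullet> ex \<le> r m \<bullet> ex"
        using monotone_onD[OF anti, of u m] monotone_onD[OF anti, of m v] uv' by auto
      ultimately show ?thesis using eq by simp
    qed
  qed
  then show "s v \<bullet> ex \<le> s u \<bullet> ex" "s u \<bullet> ex - s v \<bullet> ex \<le> max 0 (r u \<bullet> ex - r v \<bullet> ex)" by auto
qed

lemma rook_phase_antimono:
  assumes "unit_affine r" "rook_phase r s off ex ey a b" "continuous_on {a..b} s"
    "a \<le> u" "v \<le> b" "unit_step u v"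
  shows "antimono_on {u..v} (\<lambda>t. s t \<bullet> ex)"
proof (rule monotone_onI)
  fix x y assume "x \<in> {u..v}" "y \<in> {u..v}" "x \<le> y"
  then show "s y \<bullet> ex \<le> s x \<bullet> ex"
    using rook_phase_step_x(1)[OF assms(1-3), of x y] unit_step_sub[OF assms(6), of x y] assms(4,5)
    by simp
qed

lemma rook_phase_step_offset:
  assumes r: "unit_affine r" and ph: "rook_phase r s off ex ey a b"
    and s: "continuous_on {a..b} s" and "0 \<le> a" "a \<le> u" "v \<le> b" and step: "unit_step u v"
  shows "norm (off v) = norm (off u) - (1 + sqrt 3) * \<bar>r v \<bullet> ey - r u \<bullet> ey\<bar>
    - (s u \<bullet> ex - s v \<bullet> ex)"
proof -
  have uv: "u \<le> v" using step unit_step_le by blast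
  have ey: "curve_length dist (\<lambda>t. s t \<bullet> ey) a t = curve_length dist (\<lambda>t. r t \<bullet> ey) a t" if "t \<le> b" for t
    using rook_phaseD(1)[OF ph] that by (intro dist_length.curve_length_cong) simp
  have "curve_length dist (\<lambda>t. r t \<bullet> ey) a v
      = curve_length dist (\<lambda>t. r t \<bullet> ey) a u + \<bar>r v \<bullet> ey - r u \<bullet> ey\<bar>"
    using assms(4-7) uv unit_affine_monotone[OF r] by (intro piecewise_monotone_curve_length) auto
  moreover have "curve_length dist (\<lambda>t. s t \<bullet> ex) a v
      = curve_length dist (\<lambda>t. s t \<bullet> ex) a u + \<bar>s v \<bullet> ex - s u \<bullet> ex\<bar>"
    using assms(4-7) uv rook_phase_antimono[OF r ph s]
    by (intro piecewise_monotone_curve_length) auto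
  moreover have "\<bar>s v \<bullet> ex - s u \<bullet> ex\<bar> = s u \<bullet> ex - s v \<bullet> ex"
    using rook_phase_step_x(1)[OF r ph s assms(5,6) step] by simp
  moreover have "u \<in> {a..b}" "v \<in> {a..b}" "u \<le> b" "v \<le> b" using uv assms(5,6) by auto
  note rook_phaseD(4)[OF ph this(1)] rook_phaseD(4)[OF ph this(2)] ey[OF this(3)] ey[OF this(4)]
  ultimately show ?thesis by (simp add: ring_distribs)
qed

lemma rook_phase_geodesic:
  assumes r: "unit_affine r" and ax: "axes ex ey" and ph: "rook_phase r s off ex ey a b"
    and s: "continuous_on {a..b} s" and "a \<le> u" "v \<le> b" "unit_step u v"
  shows "l1_length.geodesic s u v"
proof (rule monotone_axes_geodesic[OF ax])
  show "monotone_fun (\<lambda>t. s t \<bullet> ex) u v"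
    using rook_phase_antimono[OF r ph s assms(5-7)] by blast
  have "s t \<bullet> ey = r t \<bullet> ey" if "t \<in> {u..v}" for t
    using rook_phaseD(1)[OF ph] that assms(5,6) by simp
  then show "monotone_fun (\<lambda>t. s t \<bullet> ey) u v"
    using unit_affine_monotone[OF r assms(7), of ey] by (simp add: monotone_on_def)
qed

section \<open>Executions\<close>

lemma br_executionD:
  assumes "br_execution r T R"
  shows "continuous_on {0..T} (server R)" "server R 0 = 0" "0 < phases R" "times R 0 = 0"
    "times R (phases R) = T"
    "k < phases R \<Longrightarrow> times R k \<le> times R (Suc k)"
    "k < phases R \<Longrightarrow> axes (xaxis R k) (yaxis R k)"
    "k < phases R \<Longrightarrow> even k \<Longrightarrow>
      bishop_phase r (server R) (offset R) (xaxis R k) (yaxis R k) (times R k) (times R (Suc k))"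
    "k < phases R \<Longrightarrow> odd k \<Longrightarrow>
      rook_phase r (server R) (offset R) (xaxis R k) (yaxis R k) (times R k) (times R (Suc k))"
    "Suc k < phases R \<Longrightarrow> even k \<Longrightarrow> yaxis R (Suc k) = yaxis R k"
  using assms unfolding br_execution_def by (auto split: if_splits)

lemma br_times_mono:
  assumes "br_execution r T R" "k \<le> l" "l \<le> phases R"
  shows "times R k \<le> times R l"
  using assms(2,3)
proof (induction l rule: dec_induct)
  case (step l)
  then show ?case using br_executionD(6)[OF assms(1), of l] by simp
qed simp

lemma br_times_bounds:
  assumes "br_execution r T R" "k \<le> phases R"
  shows "0 \<le> times R k" "times R k \<le> T"
  using br_times_mono[OF assms(1), of 0 k] br_times_mono[OF assms(1), of k "phases R"] assms
    br_executionD(4,5)[OF assms(1)] by auto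

lemma br_phase_continuous:
  assumes "br_execution r T R" "k < phases R"
  shows "continuous_on {times R k..times R (Suc k)} (server R)"
  using br_executionD(1)[OF assms(1)] br_times_bounds[OF assms(1), of k]
    br_times_bounds[OF assms(1), of "Suc k"] assms(2) by (auto intro: continuous_on_subset)

text \<open>Time is cut both at the phase boundaries and at the integers, so each piece lies within
  one phase and one segment of the input.\<close>

lemma br_step_induct [consumes 4, case_names step trans]:
  assumes R: "br_execution r T R" and "0 \<le> x" "x \<le> y" "y \<le> T"
    and step: "\<And>k u v. k < phases R \<Longrightarrow> times R k \<le> u \<Longrightarrow> v \<le> times R (Suc k) \<Longrightarrow> unit_step u v \<Longrightarrow> P u v"
    and trans: "\<And>u v w. 0 \<le> u \<Longrightarrow> u \<le> v \<Longrightarrow> v \<le> w \<Longrightarrow> w \<le> T \<Longrightarrow> P u v \<Longrightarrow> P v w \<Longrightarrow> P u w"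
  shows "P x y"
proof -
  have phase: "P u v" if "k < phases R" "times R k \<le> u" "u \<le> v" "v \<le> times R (Suc k)" for k u v
  proof -
    have b: "0 \<le> times R k" "times R (Suc k) \<le> T"
      using br_times_bounds[OF R] that by simp_all
    have "0 \<le> u" using b that by simp
    then show ?thesis using that(3)
    proof (induction rule: unit_step_induct)
      case (step x y)
      then show ?case using assms(5) that by (meson order_trans)
    next
      case (trans x y z)
      then show ?case using assms(6) that b by (meson order_trans)
    qed
  qed
  have "P x y" if "0 \<le> x" "x \<le> y" "y \<le> times R k" "k \<le> phases R" for k x y
    using that
  proof (induction k arbitrary: x y)
    case 0
    then have "times R 0 \<le> x" "y \<le> times R (Suc 0)"
      using br_executionD(3,4,6)[OF R] order_trans by fastforce+
    then show ?case using phase[of 0 x y] br_executionD(3)[OF R] 0 by simp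
  next
    case (Suc k)
    show ?case
    proof (cases "times R k \<le> x")
      case True
      then show ?thesis using phase[of k x y] Suc.prems by simp
    next
      case False
      show ?thesis
      proof (cases "y \<le> times R k")
        case True
        then show ?thesis using Suc by simp
      next
        case y: False
        have "P x (times R k)" using Suc.IH[of x "times R k"] Suc.prems False by simp
        moreover have "P (times R k) y" using phase[of k "times R k" y] Suc.prems y by simp
        moreover have "y \<le> T" using Suc.prems br_times_bounds(2)[OF R Suc.prems(4)] by simp
        ultimately show ?thesis using trans[of x "times R k" y] Suc.prems False y by simp
      qed
    qed
  qed
  then show ?thesis using assms(2-4) br_executionD(5)[OF R] by blast
qed

lemma br_phase_exists:
  assumes R: "br_execution r T R" and "t \<in> {0..T}"
  obtains k where "k < phases R" "t \<in> {times R k..times R (Suc k)}"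
proof -
  have "\<exists>k<phases R. t \<in> {times R k..times R (Suc k)}"
    if "t \<le> times R n" "0 < n" "n \<le> phases R" for n
    using that
  proof (induction n)
    case (Suc n)
    show ?case
    proof (cases "times R n \<le> t")
      case True
      then show ?thesis using Suc.prems by (intro exI[of _ n]) auto
    next
      case False
      then have "n \<noteq> 0" using assms br_executionD(4)[OF R] by (intro notI) auto
      then show ?thesis using Suc False by simp
    qed
  qed simp
  then show ?thesis using assms br_executionD(3,5)[OF R] that by auto
qed

lemma br_geodesic:
  assumes r: "unit_affine r" and R: "br_execution r T R" and "k < phases R" "times R k \<le> u"
    "v \<le> times R (Suc k)" "unit_step u v"
  shows "l1_length.geodesic (server R) u v"
proof (cases "even k")
  case True
  show ?thesis
    using bishop_phase_geodesic[OF r br_executionD(7,8)[OF R]] br_times_bounds(1)[OF R, of k] True assms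
    by simp
next
  case False
  show ?thesis
    using rook_phase_geodesic[OF r br_executionD(7,9)[OF R] br_phase_continuous[OF R]] False assms
    by simp
qed

lemma br_rectifiable:
  assumes r: "unit_affine r" and R: "br_execution r T R" and "0 \<le> x" "x \<le> y" "y \<le> T"
  shows "rectifiable l1_dist (server R) x y"
  using R assms(3-5)
proof (induction rule: br_step_induct)
  case (step k u v)
  then show ?case
    using br_geodesic[OF r R] l1_length.geodesic_rectifiable unit_step_le by blast
next
  case (trans u v w)
  then show ?case using l1_length.rectifiable_append by blast
qed

lemma br_curve_length_step:
  assumes r: "unit_affine r" and R: "br_execution r T R" and k: "k < phases R" "times R k \<le> u"
    "v \<le> times R (Suc k)" "unit_step u v"
  shows "curve_length l1_dist (server R) 0 v
    = curve_length l1_dist (server R) 0 u + l1_dist (server R u) (server R v)"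
proof -
  have "0 \<le> u" "u \<le> v" "v \<le> T"
    using br_times_bounds[OF R, of k] br_times_bounds[OF R, of "Suc k"] k unit_step_le by fastforce+
  then show ?thesis
    using l1_length.curve_length_append[of 0 u v "server R"] br_rectifiable[OF r R]
      l1_length.geodesic_curve_length[OF br_geodesic[OF r R k]] by simp
qed

lemma br_feasible:
  assumes r: "unit_affine r" and R: "br_execution r T R"
  shows "feasible_server r T (server R)"
  unfolding feasible_server_def
proof (intro conjI ballI)
  show "continuous_on {0..T} (server R)" "server R 0 = 0" using br_executionD[OF R] by auto
  have "0 \<le> T" using br_times_bounds(1)[OF R, of "phases R"] br_executionD(5)[OF R] by simp
  then show "rectifiable l1_dist (server R) 0 T" using br_rectifiable[OF r R] by simp
  fix t assume "t \<in> {0..T}"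
  then obtain k where k: "k < phases R" "t \<in> {times R k..times R (Suc k)}"
    by (rule br_phase_exists[OF R])
  show "aligned (server R t) (r t)"
  proof (cases "even k")
    case True
    then have "server R t \<bullet> xaxis R k = r t \<bullet> xaxis R k"
      using bishop_phaseD(1)[OF br_executionD(8)[OF R k(1)] k(2)] by blast
    then show ?thesis by (simp add: aligned_axes[OF br_executionD(7)[OF R k(1)]])
  next
    case False
    then have "server R t \<bullet> yaxis R k = r t \<bullet> yaxis R k"
      using rook_phaseD(1)[OF br_executionD(9)[OF R k(1)] k(2)] by blast
    then show ?thesis by (simp add: aligned_axes[OF br_executionD(7)[OF R k(1)]])
  qed
qed

section \<open>The potential\<close>

lemma bishop_start_offset:
  assumes "bishop_phase r s off ex ey a b" "a \<le> b"
  shows "off a = 0"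
  using bishop_phaseD(1,4)[OF assms(1), of a] assms(2) by (simp add: inner_diff_left)

text \<open>If the first phase \<open>j\<close> containing \<open>t\<close> differs from
  \<open>k\<close>, then the phases after \<open>j\<close> up to \<open>k\<close> all start at
  \<open>t\<close>. Either the only change is from a bishop to a rook phase, which keeps the y axis,
  or a bishop phase starts at \<open>t\<close>; then the offset is 0 and the bonus vanishes whatever
  the axis.\<close>

lemma potential_in_phase:
  assumes R: "br_execution r T R" and k: "k < phases R" "t \<in> {times R k..times R (Suc k)}"
  shows "potential R q t = (3 + 2 * sqrt 3) * curve_length l1_dist q 0 t
     - 3 * l1_dist (server R t + offset R t) (q t) - curve_length l1_dist (server R) 0 t
     - norm (offset R t) + offset_bonus ((q t - server R t) \<bullet> yaxis R k) (norm (offset R t))"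
proof -
  define j where "j = phase_at R t"
  have tj: "t \<le> times R (Suc j)" unfolding j_def phase_at_def
    by (rule LeastI[of _ k]) (use k in auto)
  have "j \<le> k" unfolding j_def phase_at_def by (rule Least_le) (use k in auto)
  have "yaxis R j = yaxis R k \<or> offset R t = 0"
  proof (cases "j = k")
    case False
    have t_eq: "times R m = t" if "Suc j \<le> m" "m \<le> k" for m
      using br_times_mono[OF R, of "Suc j" m] br_times_mono[OF R, of m k] that tj k by auto
    have even: "offset R t = 0" if "Suc j \<le> m" "m \<le> k" "even m" for m
      using bishop_start_offset[OF br_executionD(8)[OF R, of m]] br_executionD(6)[OF R, of m]
        that k(1) t_eq[OF that(1,2)] by simp
    show ?thesis
    proof (cases "Suc j = k \<and> even j")
      case True
      then show ?thesis using br_executionD(10)[OF R, of j] k by auto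
    next
      case F: False
      show ?thesis
      proof (cases "even j")
        case True
        then have "Suc (Suc j) \<le> k" using F \<open>j \<le> k\<close> False by simp
        then show ?thesis using even[of "Suc (Suc j)"] True by simp
      next
        case odd: False
        then show ?thesis using even[of "Suc j"] \<open>j \<le> k\<close> False by simp
      qed
    qed
  qed simp
  then show ?thesis unfolding potential_def j_def[symmetric] by (auto simp: offset_bonus_def)
qed

text \<open>Where the offline server changes between the two alignments, it meets the request and so is
  aligned both ways.\<close>

lemma alignment_switch:
  fixes u v :: real
  assumes ax: "axes ex ey" and "continuous_on {u..v} q" "continuous_on {u..v} r" "u \<le> v"
    and al: "\<And>t. t \<in> {u..v} \<Longrightarrow> aligned (q t) (r t)"
    and mono: "\<And>x y. u \<le> x \<Longrightarrow> x \<le> y \<Longrightarrow> y \<le> v \<Longrightarrow>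
      q x \<bullet> ex = r x \<bullet> ex \<and> q y \<bullet> ex = r y \<bullet> ex \<or> q x \<bullet> ey = r x \<bullet> ey \<and> q y \<bullet> ey = r y \<bullet> ey
      \<Longrightarrow> F x \<le> (F y :: real)"
  shows "F u \<le> F v"
proof -
  define A where "A e = {t \<in> {u..v}. (q t - r t) \<bullet> e = 0}" for e
  have "closed (A e)" for e unfolding A_def
    by (rule continuous_closed_preimage_constant) (auto intro!: continuous_intros assms)
  moreover have cover: "{u..v} \<subseteq> A ex \<union> A ey"
  proof
    fix t assume "t \<in> {u..v}"
    then show "t \<in> A ex \<union> A ey"
      using al[of t] by (auto simp: A_def aligned_axes[OF ax] inner_diff_left)
  qed
  moreover have "connected {u..v}" by simp
  ultimately have meet: "A ex \<inter> A ey \<inter> {u..v} \<noteq> {} \<or> A ex \<inter> {u..v} = {} \<or> A ey \<inter> {u..v} = {}"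
    unfolding connected_closed by metis
  have uv: "u \<in> {u..v}" "v \<in> {u..v}" using \<open>u \<le> v\<close> by auto
  show ?thesis
  proof (cases "A ex \<inter> A ey \<inter> {u..v} = {}")
    case True
    then have "(u \<in> A ex \<and> v \<in> A ex) \<or> (u \<in> A ey \<and> v \<in> A ey)" using meet cover uv by blast
    then show ?thesis using mono[of u v] \<open>u \<le> v\<close> by (auto simp: A_def inner_diff_left)
  next
    case False
    then obtain w where w: "w \<in> {u..v}" "q w \<bullet> ex = r w \<bullet> ex" "q w \<bullet> ey = r w \<bullet> ey"
      by (auto simp: A_def inner_diff_left)
    have "F u \<le> F w" using mono[of u w] w al[OF uv(1)] by (auto simp: aligned_axes[OF ax])
    moreover have "F w \<le> F v" using mono[of w v] w al[OF uv(2)] by (auto simp: aligned_axes[OF ax])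
    ultimately show ?thesis by simp
  qed
qed

text \<open>In a bishop phase the offset cancels the displacement of the server from the phase
  origin, so the shifted server stays on the vertical line through that origin. This line is the
  fixed \<open>x0\<close> of \<open>bishop_step\<close>.\<close>

lemma bishop_potential_step:
  assumes r: "unit_affine r" and R: "br_execution r T R"
    and k: "k < phases R" "times R k \<le> u" "v \<le> times R (Suc k)" "unit_step u v" and "even k"
    and al: "q u \<bullet> xaxis R k = r u \<bullet> xaxis R k \<and> q v \<bullet> xaxis R k = r v \<bullet> xaxis R k
      \<or> q u \<bullet> yaxis R k = r u \<bullet> yaxis R k \<and> q v \<bullet> yaxis R k = r v \<bullet> yaxis R k"
    and opt: "curve_length l1_dist q 0 u + l1_dist (q u) (q v) \<le> curve_length l1_dist q 0 v"
  shows "potential R q u \<le> potential R q v"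
proof -
  define ex ey a where "ex = xaxis R k" and "ey = yaxis R k" and "a = times R k"
  define s where "s = server R"
  have uv: "u \<le> v" using k unit_step_le by blast
  have uv_in: "u \<in> {u, v}" "v \<in> {u, v}" by auto
  have ax: "axes ex ey" using br_executionD(7)[OF R k(1)] by (simp add: ex_def ey_def)
  have ph: "bishop_phase r s (offset R) ex ey a (times R (Suc k))"
    using br_executionD(8)[OF R k(1) \<open>even k\<close>] by (simp add: ex_def ey_def a_def s_def)
  have st: "s t \<bullet> ex = r t \<bullet> ex" "r t \<bullet> ey \<le> s t \<bullet> ey"
    "offset R t = - (((s t - r a) \<bullet> ex) *\<^sub>R ex)" if "t \<in> {u, v}" for t
    using bishop_phaseD[OF ph, of t] that k uv by (auto simp: a_def)
  have eq: "potential R q t = (3 + 2 * sqrt 3) * curve_length l1_dist q 0 t - curve_length l1_dist s 0 t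
    + (- 3 * \<bar>r a \<bullet> ex - q t \<bullet> ex\<bar> - \<bar>r t \<bullet> ex - r a \<bullet> ex\<bar>
       + vertical_gain (q t \<bullet> ey - s t \<bullet> ey) \<bar>r t \<bullet> ex - r a \<bullet> ex\<bar>)" if "t \<in> {u, v}" for t
  proof -
    have "t \<in> {times R k..times R (Suc k)}" using that k uv by auto
    moreover have "norm (offset R t) = \<bar>r t \<bullet> ex - r a \<bullet> ex\<bar>"
      using st[OF that] ax by (simp add: inner_diff_left)
    moreover have "l1_dist (s t + offset R t) (q t) = \<bar>r a \<bullet> ex - q t \<bullet> ex\<bar> + \<bar>q t \<bullet> ey - s t \<bullet> ey\<bar>"
      using st(1,3)[OF that] ax by (simp add: l1_dist_axes[OF ax] inner_simps)
    ultimately show ?thesis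
      by (simp add: potential_in_phase[OF R k(1)] vertical_gain_def inner_diff_left
          s_def[symmetric] ey_def[symmetric])
  qed
  have sv: "s v \<bullet> ey = s u \<bullet> ey - \<bar>r v \<bullet> ex - r u \<bullet> ex\<bar>"
    using bishop_phase_step[OF r ph] k br_times_bounds(1)[OF R, of k] by (simp add: a_def)
  have "- 3 * \<bar>r a \<bullet> ex - q u \<bullet> ex\<bar> - \<bar>r u \<bullet> ex - r a \<bullet> ex\<bar>
      + vertical_gain (q u \<bullet> ey - s u \<bullet> ey) \<bar>r u \<bullet> ex - r a \<bullet> ex\<bar>
    \<le> (3 + 2 * sqrt 3) * (\<bar>q u \<bullet> ex - q v \<bullet> ex\<bar> + \<bar>q u \<bullet> ey - q v \<bullet> ey\<bar>)
      - 2 * \<bar>r v \<bullet> ex - r u \<bullet> ex\<bar> - 3 * \<bar>r a \<bullet> ex - q v \<bullet> ex\<bar> - \<bar>r v \<bullet> ex - r a \<bullet> ex\<bar>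
      + vertical_gain (q v \<bullet> ey - s v \<bullet> ey) \<bar>r v \<bullet> ex - r a \<bullet> ex\<bar>"
    using bishop_step[OF sv st(2)[OF uv_in(1)] st(2)[OF uv_in(2)]] al by (simp add: ex_def ey_def)
  moreover have "(3 + 2 * sqrt 3) * (curve_length l1_dist q 0 u + l1_dist (q u) (q v))
      \<le> (3 + 2 * sqrt 3) * curve_length l1_dist q 0 v"
    using opt by (intro mult_left_mono) auto
  moreover have "curve_length l1_dist s 0 v
      = curve_length l1_dist s 0 u + 2 * \<bar>r v \<bullet> ex - r u \<bullet> ex\<bar>"
    using br_curve_length_step[OF r R k] sv st
    by (simp add: l1_dist_axes[OF ax] s_def[symmetric] abs_minus_commute)
  moreover note eq[OF uv_in(1)] eq[OF uv_in(2)]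
  ultimately show ?thesis unfolding l1_dist_axes[OF ax] ring_distribs by argo
qed

lemma rook_potential_step:
  assumes r: "unit_affine r" and R: "br_execution r T R"
    and k: "k < phases R" "times R k \<le> u" "v \<le> times R (Suc k)" "unit_step u v" and "odd k"
    and al: "q u \<bullet> xaxis R k = r u \<bullet> xaxis R k \<and> q v \<bullet> xaxis R k = r v \<bullet> xaxis R k
      \<or> q u \<bullet> yaxis R k = r u \<bullet> yaxis R k \<and> q v \<bullet> yaxis R k = r v \<bullet> yaxis R k"
    and opt: "curve_length l1_dist q 0 u + l1_dist (q u) (q v) \<le> curve_length l1_dist q 0 v"
  shows "potential R q u \<le> potential R q v"
proof -
  define ex ey where "ex = xaxis R k" and "ey = yaxis R k"
  define s where "s = server R"
  define w where "w t = norm (offset R t)" for t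
  have uv: "u \<le> v" using k unit_step_le by blast
  have uv_in: "u \<in> {u, v}" "v \<in> {u, v}" by auto
  have ax: "axes ex ey" using br_executionD(7)[OF R k(1)] by (simp add: ex_def ey_def)
  have ph: "rook_phase r s (offset R) ex ey (times R k) (times R (Suc k))"
    using br_executionD(9)[OF R k(1) \<open>odd k\<close>] by (simp add: ex_def ey_def s_def)
  have cont: "continuous_on {times R k..times R (Suc k)} s"
    using br_phase_continuous[OF R k(1)] by (simp add: s_def)
  have st: "s t \<bullet> ey = r t \<bullet> ey" "s t \<bullet> ex \<le> r t \<bullet> ex" "offset R t = - (w t *\<^sub>R ex)"
    if "t \<in> {u, v}" for t
    using rook_phaseD[OF ph, of t] that k uv by (auto simp: w_def)
  have eq: "potential R q t = (3 + 2 * sqrt 3) * curve_length l1_dist q 0 t - curve_length l1_dist s 0 t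
    + (- 3 * \<bar>s t \<bullet> ex - w t - q t \<bullet> ex\<bar> - w t + vertical_gain (q t \<bullet> ey - r t \<bullet> ey) (w t))"
    if "t \<in> {u, v}" for t
  proof -
    have "t \<in> {times R k..times R (Suc k)}" using that k uv by auto
    moreover have "l1_dist (s t + offset R t) (q t)
        = \<bar>s t \<bullet> ex - w t - q t \<bullet> ex\<bar> + \<bar>q t \<bullet> ey - r t \<bullet> ey\<bar>"
      using st(1,3)[OF that] ax by (simp add: l1_dist_axes[OF ax] inner_simps)
    ultimately show ?thesis
      using st(1)[OF that]
      by (simp add: potential_in_phase[OF R k(1)] vertical_gain_def inner_diff_left
          s_def[symmetric] ey_def[symmetric] w_def[symmetric])
  qed
  have sx: "s v \<bullet> ex \<le> s u \<bullet> ex" "s u \<bullet> ex - s v \<bullet> ex \<le> max 0 (r u \<bullet> ex - r v \<bullet> ex)"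
    using rook_phase_step_x[OF r ph cont k(2-4)] by auto
  have wv: "w v = w u - (1 + sqrt 3) * \<bar>r v \<bullet> ey - r u \<bullet> ey\<bar> - (s u \<bullet> ex - s v \<bullet> ex)"
    using rook_phase_step_offset[OF r ph cont _ k(2-4)] br_times_bounds(1)[OF R, of k] k
    by (simp add: w_def)
  have "- 3 * \<bar>s u \<bullet> ex - w u - q u \<bullet> ex\<bar> - w u + vertical_gain (q u \<bullet> ey - r u \<bullet> ey) (w u)
    \<le> (3 + 2 * sqrt 3) * (\<bar>q u \<bullet> ex - q v \<bullet> ex\<bar> + \<bar>q u \<bullet> ey - q v \<bullet> ey\<bar>)
      - (\<bar>r v \<bullet> ey - r u \<bullet> ey\<bar> + (s u \<bullet> ex - s v \<bullet> ex))
      - 3 * \<bar>s v \<bullet> ex - w v - q v \<bullet> ex\<bar> - w v + vertical_gain (q v \<bullet> ey - r v \<bullet> ey) (w v)"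
    using rook_step[OF _ _ wv st(2)[OF uv_in(1)] st(2)[OF uv_in(2)] sx] al
    by (simp add: ex_def ey_def w_def)
  moreover have "(3 + 2 * sqrt 3) * (curve_length l1_dist q 0 u + l1_dist (q u) (q v))
      \<le> (3 + 2 * sqrt 3) * curve_length l1_dist q 0 v"
    using opt by (intro mult_left_mono) auto
  moreover have "curve_length l1_dist s 0 v
      = curve_length l1_dist s 0 u + (\<bar>r v \<bullet> ey - r u \<bullet> ey\<bar> + (s u \<bullet> ex - s v \<bullet> ex))"
    using br_curve_length_step[OF r R k] sx(1) st
    by (simp add: l1_dist_axes[OF ax] s_def[symmetric] abs_minus_commute)
  moreover note eq[OF uv_in(1)] eq[OF uv_in(2)]
  ultimately show ?thesis unfolding l1_dist_axes[OF ax] ring_distribs by argo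
qed

lemma potential_le:
  assumes r: "unit_affine r" and R: "br_execution r T R" and q: "feasible_server r T q"
    and "0 \<le> x" "x \<le> y" "y \<le> T"
  shows "potential R q x \<le> potential R q y"
  using R assms(4-6)
proof (induction rule: br_step_induct)
  case (step k u v)
  have bounds: "0 \<le> u" "v \<le> T"
    using br_times_bounds[OF R, of k] br_times_bounds[OF R, of "Suc k"] step by simp_all
  have rect: "rectifiable l1_dist q 0 T" using q unfolding feasible_server_def by blast
  show ?case
  proof (rule alignment_switch[OF br_executionD(7)[OF R step(1)], where u = u and v = v and
        F = "potential R q" and q = q and r = r])
    show "continuous_on {u..v} q"
      using q bounds unfolding feasible_server_def by (auto intro: continuous_on_subset)
    show "continuous_on {u..v} r" by (rule unit_affine_continuous[OF r step(4)])
    show "u \<le> v" by (rule unit_step_le[OF step(4)])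
    show "aligned (q t) (r t)" if "t \<in> {u..v}" for t
      using q that bounds unfolding feasible_server_def by auto
    fix x y assume xy: "u \<le> x" "x \<le> y" "y \<le> v"
      and al: "q x \<bullet> xaxis R k = r x \<bullet> xaxis R k \<and> q y \<bullet> xaxis R k = r y \<bullet> xaxis R k
        \<or> q x \<bullet> yaxis R k = r x \<bullet> yaxis R k \<and> q y \<bullet> yaxis R k = r y \<bullet> yaxis R k"
    have xy': "times R k \<le> x" "y \<le> times R (Suc k)" "unit_step x y"
      using xy step unit_step_sub[OF step(4) xy] by auto
    \<comment> \<open>The offline server is charged only for the chord between its two positions;
      its actual path is at least as long.\<close>
    have "rectifiable l1_dist q 0 x" "rectifiable l1_dist q x y"
      using l1_length.rectifiable_subinterval[OF rect] xy bounds by auto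
    then have "curve_length l1_dist q 0 x + l1_dist (q x) (q y) \<le> curve_length l1_dist q 0 y"
      using l1_length.curve_length_append[of 0 x y q] l1_length.dist_le_curve_length[of q x y]
        xy bounds by simp
    then show "potential R q x \<le> potential R q y"
      using bishop_potential_step[OF r R step(1) xy' _ al]
        rook_potential_step[OF r R step(1) xy' _ al] by blast
  qed
qed (rule order_trans)

text \<open>The potential starts at 0, so it is nonnegative at the end. There the positive bonus
  must be absorbed: the offset is horizontal, hence the vertical displacement is at most the
  distance term, and the slope 6 - 2 sqrt 3 of the bonus is at most the weight 3 of that
  term.\<close>

lemma br_cost_le:
  assumes r: "unit_affine r" "r 0 = 0" and R: "br_execution r T R" and q: "feasible_server r T q"
  shows "curve_length l1_dist (server R) 0 T \<le> (3 + 2 * sqrt 3) * curve_length l1_dist q 0 T"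
proof -
  have T: "0 \<le> T" using br_times_bounds(1)[OF R, of "phases R"] br_executionD(5)[OF R] by simp
  have "offset R 0 = 0"
    using bishop_start_offset[OF br_executionD(8)[OF R, of 0]] br_executionD(3,4,6)[OF R] by force
  then have "potential R q 0 = 0"
    using q br_executionD(2)[OF R]
    by (simp add: potential_def feasible_server_def l1_dist_def offset_bonus_def)
  then have "0 \<le> potential R q T" using potential_le[OF r(1) R q] T by fastforce
  moreover obtain k where k: "k < phases R" "T \<in> {times R k..times R (Suc k)}"
    using br_phase_exists[OF R, of T] T by auto
  define ex ey s off where "ex = xaxis R k" and "ey = yaxis R k" and "s = server R T"
    and "off = offset R T"
  have ax: "axes ex ey" using br_executionD(7)[OF R k(1)] by (simp add: ex_def ey_def)
  have "off \<bullet> ey = 0"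
  proof (cases "even k")
    case True
    then have "off = - (((s - r (times R k)) \<bullet> ex) *\<^sub>R ex)"
      using bishop_phaseD(4)[OF br_executionD(8)[OF R k(1)] k(2)] by (simp add: off_def s_def ex_def)
    then show ?thesis using ax by simp
  next
    case False
    then have "off = - (norm off *\<^sub>R ex)"
      using rook_phaseD(3)[OF br_executionD(9)[OF R k(1)] k(2)] unfolding off_def ex_def by blast
    then have "off \<bullet> ey = - (norm off *\<^sub>R ex) \<bullet> ey" by (rule arg_cong)
    then show ?thesis using ax by simp
  qed
  then have "\<bar>(q T - s) \<bullet> ey\<bar> \<le> l1_dist (s + off) (q T)"
    by (simp add: l1_dist_axes[OF ax] inner_simps)
  moreover have "offset_bonus ((q T - s) \<bullet> ey) (norm off) \<le> 3 * \<bar>(q T - s) \<bullet> ey\<bar>"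
  proof -
    have "(6 - 2 * sqrt 3) * max 0 (min ((q T - s) \<bullet> ey) (norm off)) \<le> 3 * \<bar>(q T - s) \<bullet> ey\<bar>"
      using sqrt3_bounds(2) by (intro mult_mono) auto
    then show ?thesis by (simp add: offset_bonus_eq)
  qed
  moreover have "potential R q T = (3 + 2 * sqrt 3) * curve_length l1_dist q 0 T
     - 3 * l1_dist (s + off) (q T) - curve_length l1_dist (server R) 0 T
     - norm off + offset_bonus ((q T - s) \<bullet> ey) (norm off)"
    using potential_in_phase[OF R k] by (simp add: s_def off_def ey_def)
  moreover have "0 \<le> norm off" by simp
  ultimately show ?thesis by argo
qed

lemma br_competitive:
  assumes r: "unit_affine r" "r 0 = 0" and R: "br_execution r T R"
  shows "curve_length l1_dist (server R) 0 T \<le> (3 + 2 * sqrt 3) * opt_cost r T"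
proof -
  have c: "0 < 3 + 2 * sqrt (3 :: real)" by (intro add_pos_nonneg) auto
  have "curve_length l1_dist (server R) 0 T / (3 + 2 * sqrt 3) \<le> opt_cost r T"
    unfolding opt_cost_def
  proof (rule cINF_greatest)
    \<comment> \<open>The BR server itself shows that the infimum is taken over a nonempty
      set.\<close>
    show "{q. feasible_server r T q} \<noteq> {}" using br_feasible[OF r(1) R] by blast
    fix q assume "q \<in> {q. feasible_server r T q}"
    then show "curve_length l1_dist (server R) 0 T / (3 + 2 * sqrt 3) \<le> curve_length l1_dist q 0 T"
      using br_cost_le[OF r R] c by (simp add: field_simps)
  qed
  then show ?thesis using c by (simp add: field_simps)
qed

section \<open>Existence of executions\<close>

lemma bishop_phase_meet:
  assumes "bishop_phase r s off ex ey a b" "t \<in> {a<..<b}" "s t = r t" "u \<in> {a..t}"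
  shows "s u = r u"
  using assms unfolding bishop_phase_def by blast

lemma bishop_phase_cong:
  assumes "bishop_phase r s off ex ey a b" "\<And>t. t \<in> {a..b} \<Longrightarrow> s' t = s t" "\<And>t. t \<in> {a..b} \<Longrightarrow> off' t = off t"
  shows "bishop_phase r s' off' ex ey a b"
proof (cases "a \<le> b")
  case True
  then have a: "s' a = s a" using assms(2)[of a] by simp
  have "s' t \<bullet> ex = r t \<bullet> ex \<and> s' t \<bullet> ey = s' a \<bullet> ey - curve_length dist (\<lambda>u. r u \<bullet> ex) a t
      \<and> r t \<bullet> ey \<le> s' t \<bullet> ey \<and> off' t = - (((s' t - r a) \<bullet> ex) *\<^sub>R ex)" if "t \<in> {a..b}" for t
    unfolding assms(2,3)[OF that] a using bishop_phaseD[OF assms(1) that] by blast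
  moreover have "s' u = r u" if "t \<in> {a<..<b}" "s' t = r t" "u \<in> {a..t}" for t u
    using bishop_phase_meet[OF assms(1), of t u] assms(2) that by simp
  ultimately show ?thesis unfolding bishop_phase_def by blast
qed (simp add: bishop_phase_def)

text \<open>The clause of \<open>rook_phase\<close> that quantifies over pairs of times. It is
  separated because joining two intervals takes an argument for pairs on different sides of the
  joint.\<close>

definition rook_moves :: "(real \<Rightarrow> point) \<Rightarrow> (real \<Rightarrow> point) \<Rightarrow> point \<Rightarrow> real \<Rightarrow> real \<Rightarrow> bool" where
  "rook_moves r s ex a b \<longleftrightarrow> (\<forall>u v. a \<le> u \<and> u \<le> v \<and> v \<le> b \<longrightarrow>
     ((\<forall>t\<in>{u<..<v}. s t \<bullet> ex < r t \<bullet> ex) \<longrightarrow> s v \<bullet> ex = s u \<bullet> ex) \<and>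
     (mono_on {u..v} (\<lambda>t. r t \<bullet> ex) \<longrightarrow> s v \<bullet> ex = s u \<bullet> ex) \<and>
     (s u \<bullet> ex = r u \<bullet> ex \<and> antimono_on {u..v} (\<lambda>t. r t \<bullet> ex) \<longrightarrow> s v \<bullet> ex = r v \<bullet> ex))"

lemma rook_phase_alt:
  "rook_phase r s off ex ey a b \<longleftrightarrow>
     (\<forall>t\<in>{a..b}. s t \<bullet> ey = r t \<bullet> ey \<and> s t \<bullet> ex \<le> r t \<bullet> ex) \<and> rook_moves r s ex a b \<and>
     (\<forall>t\<in>{a..b}.
        off t = - (norm (off t) *\<^sub>R ex) \<and>
        norm (off t) = norm (off a)
          - (1 + sqrt 3) * curve_length dist (\<lambda>u. s u \<bullet> ey) a t
          - curve_length dist (\<lambda>u. s u \<bullet> ex) a t) \<and>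
     (\<forall>t\<in>{a..<b}. off t \<noteq> 0)"
  unfolding rook_phase_def rook_moves_def by (rule refl)

lemma rook_movesD:
  assumes "rook_moves r s ex a b" "a \<le> u" "u \<le> v" "v \<le> b"
  shows "(\<And>t. t \<in> {u<..<v} \<Longrightarrow> s t \<bullet> ex < r t \<bullet> ex) \<Longrightarrow> s v \<bullet> ex = s u \<bullet> ex"
    "mono_on {u..v} (\<lambda>t. r t \<bullet> ex) \<Longrightarrow> s v \<bullet> ex = s u \<bullet> ex"
    "s u \<bullet> ex = r u \<bullet> ex \<Longrightarrow> antimono_on {u..v} (\<lambda>t. r t \<bullet> ex) \<Longrightarrow> s v \<bullet> ex = r v \<bullet> ex"
  using assms unfolding rook_moves_def by blast+

lemma rook_movesI:
  assumes "\<And>u v. a \<le> u \<Longrightarrow> u < v \<Longrightarrow> v \<le> b \<Longrightarrow>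
      (\<And>t. t \<in> {u<..<v} \<Longrightarrow> s t \<bullet> ex < r t \<bullet> ex) \<Longrightarrow> s v \<bullet> ex = s u \<bullet> ex"
    and "\<And>u v. a \<le> u \<Longrightarrow> u < v \<Longrightarrow> v \<le> b \<Longrightarrow>
      mono_on {u..v} (\<lambda>t. r t \<bullet> ex) \<Longrightarrow> s v \<bullet> ex = s u \<bullet> ex"
    and "\<And>u v. a \<le> u \<Longrightarrow> u < v \<Longrightarrow> v \<le> b \<Longrightarrow> s u \<bullet> ex = r u \<bullet> ex \<Longrightarrow>
      antimono_on {u..v} (\<lambda>t. r t \<bullet> ex) \<Longrightarrow> s v \<bullet> ex = r v \<bullet> ex"
  shows "rook_moves r s ex a b"
  unfolding rook_moves_def
proof (intro allI impI)
  fix u v assume uv: "a \<le> u \<and> u \<le> v \<and> v \<le> b"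
  show "((\<forall>t\<in>{u<..<v}. s t \<bullet> ex < r t \<bullet> ex) \<longrightarrow> s v \<bullet> ex = s u \<bullet> ex) \<and>
     (mono_on {u..v} (\<lambda>t. r t \<bullet> ex) \<longrightarrow> s v \<bullet> ex = s u \<bullet> ex) \<and>
     (s u \<bullet> ex = r u \<bullet> ex \<and> antimono_on {u..v} (\<lambda>t. r t \<bullet> ex) \<longrightarrow> s v \<bullet> ex = r v \<bullet> ex)"
  proof (cases "u = v")
    case False
    then have "u < v" using uv by simp
    then show ?thesis using assms[of u v] uv by blast
  qed simp
qed

lemma rook_moves_cong:
  assumes "rook_moves r s ex a b" and s: "\<And>t. t \<in> {a..b} \<Longrightarrow> s' t = s t"
  shows "rook_moves r s' ex a b"
proof (rule rook_movesI)
  fix u v assume uv: "a \<le> u" "u < v" "v \<le> b"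
  have eq: "s' t = s t" if "t \<in> {u..v}" for t using that s uv by simp
  note M = rook_movesD[OF assms(1) uv(1) less_imp_le[OF uv(2)] uv(3)]
  show "s' v \<bullet> ex = s' u \<bullet> ex" if "\<And>t. t \<in> {u<..<v} \<Longrightarrow> s' t \<bullet> ex < r t \<bullet> ex"
    using M(1) that eq uv by simp
  show "s' v \<bullet> ex = s' u \<bullet> ex" if "mono_on {u..v} (\<lambda>t. r t \<bullet> ex)"
    using M(2) that eq uv by simp
  show "s' v \<bullet> ex = r v \<bullet> ex" if "s' u \<bullet> ex = r u \<bullet> ex" "antimono_on {u..v} (\<lambda>t. r t \<bullet> ex)"
    using M(3) that eq uv by simp
qed

text \<open>A pair of times around \<open>b\<close> is split at \<open>b\<close>. For the third
  rule, its conclusion at \<open>b\<close> is the premise that starts it on the second half.\<close>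

lemma rook_moves_append:
  assumes "rook_moves r s ex a b" "rook_moves r s ex b c"
  shows "rook_moves r s ex a c"
proof (rule rook_movesI)
  fix u v assume uv: "a \<le> u" "u < v" "v \<le> c"
  consider "v \<le> b" | "b \<le> u" | "u < b" "b < v" by linarith
  then have "((\<forall>t\<in>{u<..<v}. s t \<bullet> ex < r t \<bullet> ex) \<longrightarrow> s v \<bullet> ex = s u \<bullet> ex) \<and>
     (mono_on {u..v} (\<lambda>t. r t \<bullet> ex) \<longrightarrow> s v \<bullet> ex = s u \<bullet> ex) \<and>
     (s u \<bullet> ex = r u \<bullet> ex \<and> antimono_on {u..v} (\<lambda>t. r t \<bullet> ex) \<longrightarrow> s v \<bullet> ex = r v \<bullet> ex)"
  proof cases
    case 1
    then show ?thesis using rook_movesD[OF assms(1), of u v] uv by simp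
  next
    case 2
    then show ?thesis using rook_movesD[OF assms(2), of u v] uv by simp
  next
    case 3
    note M = rook_movesD[OF assms(1), of u b] rook_movesD[OF assms(2), of b v]
    have "b \<in> {u<..<v}" "{u..b} \<subseteq> {u..v}" "{b..v} \<subseteq> {u..v}" using 3 by auto
    note sub = this(1) monotone_on_subset[OF _ this(2)] monotone_on_subset[OF _ this(3)]
    show ?thesis
    proof (intro conjI impI)
      assume *: "\<forall>t\<in>{u<..<v}. s t \<bullet> ex < r t \<bullet> ex"
      then have "s b \<bullet> ex = s u \<bullet> ex" "s v \<bullet> ex = s b \<bullet> ex" using M(1,4) 3 uv by simp_all
      then show "s v \<bullet> ex = s u \<bullet> ex" by simp
    next
      assume "mono_on {u..v} (\<lambda>t. r t \<bullet> ex)"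
      then show "s v \<bullet> ex = s u \<bullet> ex" using M(2,5) sub(2,3) 3 uv by force
    next
      assume "s u \<bullet> ex = r u \<bullet> ex \<and> antimono_on {u..v} (\<lambda>t. r t \<bullet> ex)"
      then show "s v \<bullet> ex = r v \<bullet> ex" using M(3,6) sub(2,3) 3 uv by force
    qed
  qed
  then show "(\<And>t. t \<in> {u<..<v} \<Longrightarrow> s t \<bullet> ex < r t \<bullet> ex) \<Longrightarrow> s v \<bullet> ex = s u \<bullet> ex"
    "mono_on {u..v} (\<lambda>t. r t \<bullet> ex) \<Longrightarrow> s v \<bullet> ex = s u \<bullet> ex"
    "s u \<bullet> ex = r u \<bullet> ex \<Longrightarrow> antimono_on {u..v} (\<lambda>t. r t \<bullet> ex) \<Longrightarrow> s v \<bullet> ex = r v \<bullet> ex"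
    by blast+
qed

lemma rook_phase_cong:
  assumes ph: "rook_phase r s off ex ey a b"
    and s: "\<And>t. t \<in> {a..b} \<Longrightarrow> s' t = s t" and off: "\<And>t. t \<in> {a..b} \<Longrightarrow> off' t = off t"
  shows "rook_phase r s' off' ex ey a b"
  unfolding rook_phase_alt
proof (intro conjI ballI)
  fix t assume t: "t \<in> {a..b}"
  show "s' t \<bullet> ey = r t \<bullet> ey" "s' t \<bullet> ex \<le> r t \<bullet> ex" "off' t = - (norm (off' t) *\<^sub>R ex)"
    unfolding s[OF t] off[OF t] using rook_phaseD[OF ph t] by blast+
  have "a \<in> {a..b}" using t by simp
  moreover have "curve_length dist (\<lambda>u. s' u \<bullet> e) a t = curve_length dist (\<lambda>u. s u \<bullet> e) a t" for e
    using s t by (intro dist_length.curve_length_cong) simp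
  ultimately show "norm (off' t) = norm (off' a) - (1 + sqrt 3) * curve_length dist (\<lambda>u. s' u \<bullet> ey) a t
      - curve_length dist (\<lambda>u. s' u \<bullet> ex) a t"
    using rook_phaseD(4)[OF ph t] off[OF t] off[of a] by simp
next
  fix t assume "t \<in> {a..<b}"
  then show "off' t \<noteq> 0" using ph off[of t] unfolding rook_phase_def by simp
next
  show "rook_moves r s' ex a b" using ph s rook_moves_cong unfolding rook_phase_alt by metis
qed

section \<open>Prolonging and switching phases\<close>

text \<open>The last phase has only been cut off by the horizon, so a later horizon prolongs it
  instead of opening a new phase. In this way a phase can continue over several segments of the
  input.\<close>

lemma extend_execution:
  assumes R: "br_execution r T R" and n: "phases R = Suc n" and "T \<le> T'"
    and s: "\<And>t. t \<le> T \<Longrightarrow> s t = server R t" and off: "\<And>t. t \<le> T \<Longrightarrow> off t = offset R t"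
    and cont: "continuous_on {0..T'} s"
    and ph: "if even n then bishop_phase r s off (xaxis R n) (yaxis R n) (times R n) T'
      else rook_phase r s off (xaxis R n) (yaxis R n) (times R n) T'"
  shows "br_execution r T' (R\<lparr>times := (times R)(Suc n := T'), server := s, offset := off\<rparr>)"
proof -
  note D = br_executionD[OF R]
  have T: "0 \<le> T" "times R k \<le> T" if "k \<le> Suc n" for k
    using br_times_bounds[OF R, of k] br_times_bounds[OF R, of "Suc n"] that n by auto
  have phase: "if even k then bishop_phase r s off (xaxis R k) (yaxis R k) (times R k) (times R (Suc k))
      else rook_phase r s off (xaxis R k) (yaxis R k) (times R k) (times R (Suc k))" if "k < n" for k
  proof -
    have "times R (Suc k) \<le> T" "k < phases R" using T(2)[of "Suc k"] that n by auto
    then show ?thesis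
      using bishop_phase_cong[OF D(8)[of k], of s off] rook_phase_cong[OF D(9)[of k], of s off] s off
      by auto
  qed
  have switch: "if even k
         then server R (times R (Suc k)) = r (times R (Suc k)) \<and>
              yaxis R (Suc k) = yaxis R k \<and> xaxis R (Suc k) \<in> {xaxis R k, - xaxis R k}
         else offset R (times R (Suc k)) = 0" if "Suc k < Suc n" for k
    using R that n unfolding br_execution_def by metis
  have "xaxis R (Suc k) = xaxis R k" if "Suc k < Suc n" "even k" "xaxis R (Suc k) \<noteq> - xaxis R k" for k
    using switch[OF that(1)] that(2,3) by simp
  note switch = switch this
  have "times R n \<le> T'" using T(2)[of n] \<open>T \<le> T'\<close> by simp
  moreover have "s 0 = 0" using s[of 0] T(1)[of 0] D(2) by simp
  moreover have "s (times R (Suc k)) = server R (times R (Suc k))"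
    "off (times R (Suc k)) = offset R (times R (Suc k))" if "Suc k < Suc n" for k
    using s off T(2)[of "Suc k"] that by auto
  ultimately show ?thesis
    unfolding br_execution_def using cont D(4) D(6,7)[unfolded n] phase ph switch n
    by (auto simp: less_Suc_eq)
qed

text \<open>The new phase has duration zero and is prolonged afterwards by
  \<open>extend_execution\<close>. Thus a switch is checked at a single time, where the conditions
  on motion are trivial.\<close>

lemma append_phase:
  assumes R: "br_execution r T R" and n: "phases R = Suc n" and ax: "axes ex ey"
    and ph: "if even n then rook_phase r (server R) (offset R) ex ey T T
      else bishop_phase r (server R) (offset R) ex ey T T"
    and sw: "if even n then server R T = r T \<and> ey = yaxis R n \<and> ex \<in> {xaxis R n, - xaxis R n}
      else offset R T = 0"
  shows "br_execution r T (R\<lparr>phases := Suc (Suc n), times := (times R)(Suc (Suc n) := T),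
    xaxis := (xaxis R)(Suc n := ex), yaxis := (yaxis R)(Suc n := ey)\<rparr>)"
proof -
  note D = br_executionD[OF R]
  have T: "times R (Suc n) = T" using D(5) n by simp
  have phase: "if even k
      then bishop_phase r (server R) (offset R) (xaxis R k) (yaxis R k) (times R k) (times R (Suc k))
      else rook_phase r (server R) (offset R) (xaxis R k) (yaxis R k) (times R k) (times R (Suc k))"
    if "k < Suc n" for k
    using D(8,9)[of k] that n by auto
  have switch: "if even k
         then server R (times R (Suc k)) = r (times R (Suc k)) \<and>
              yaxis R (Suc k) = yaxis R k \<and> xaxis R (Suc k) \<in> {xaxis R k, - xaxis R k}
         else offset R (times R (Suc k)) = 0" if "k < n" for k
    using R that n unfolding br_execution_def by (metis Suc_mono)
  have "xaxis R (Suc k) = xaxis R k" if "k < n" "even k" "xaxis R (Suc k) \<noteq> - xaxis R k" for k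
    using switch[OF that(1)] that(2,3) by simp
  note switch = switch this
  show ?thesis
    unfolding br_execution_def using D(1,2,4) D(6,7)[unfolded n] phase switch ax ph sw T
    by (auto simp: less_Suc_eq)
qed

text \<open>The start \<open>a\<close> of the last phase is recorded because the construction
  continues a bishop phase from a coincidence only if the phase has just started.\<close>

definition ends_in_bishop :: "(real \<Rightarrow> point) \<Rightarrow> real \<Rightarrow> br_run \<Rightarrow> point \<Rightarrow> point \<Rightarrow> real \<Rightarrow> bool" where
  "ends_in_bishop r T R ex ey a \<longleftrightarrow> br_execution r T R \<and>
     (\<exists>n. phases R = Suc n \<and> even n \<and> xaxis R n = ex \<and> yaxis R n = ey \<and> times R n = a)"

definition ends_in_rook :: "(real \<Rightarrow> point) \<Rightarrow> real \<Rightarrow> br_run \<Rightarrow> point \<Rightarrow> point \<Rightarrow> bool" where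
  "ends_in_rook r T R ex ey \<longleftrightarrow> br_execution r T R \<and>
     (\<exists>n. phases R = Suc n \<and> odd n \<and> xaxis R n = ex \<and> yaxis R n = ey)"

lemma ends_in_bishopE:
  assumes "ends_in_bishop r T R ex ey a"
  obtains n where "br_execution r T R" "phases R = Suc n" "even n" "xaxis R n = ex" "yaxis R n = ey"
    "times R n = a" "0 \<le> a" "a \<le> T" "axes ex ey" "bishop_phase r (server R) (offset R) ex ey a T"
proof -
  obtain n where R: "br_execution r T R"
    and n: "phases R = Suc n" "even n" "xaxis R n = ex" "yaxis R n = ey" "times R n = a"
    using assms unfolding ends_in_bishop_def by blast
  have "bishop_phase r (server R) (offset R) ex ey a T"
    using br_executionD(8)[OF R, of n] br_executionD(5)[OF R] n by simp
  then show ?thesis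
    using that[OF R n] br_times_bounds[OF R, of n] br_executionD(7)[OF R, of n] n by simp
qed

lemma ends_in_rookE:
  assumes "ends_in_rook r T R ex ey"
  obtains n where "br_execution r T R" "phases R = Suc n" "odd n" "xaxis R n = ex" "yaxis R n = ey"
    "0 \<le> times R n" "times R n \<le> T" "axes ex ey"
    "rook_phase r (server R) (offset R) ex ey (times R n) T"
proof -
  obtain n where R: "br_execution r T R"
    and n: "phases R = Suc n" "odd n" "xaxis R n = ex" "yaxis R n = ey"
    using assms unfolding ends_in_rook_def by blast
  have "rook_phase r (server R) (offset R) ex ey (times R n) T"
    using br_executionD(9)[OF R, of n] br_executionD(5)[OF R] n by simp
  then show ?thesis
    using that[OF R n] br_times_bounds[OF R, of n] br_executionD(7)[OF R, of n] n by simp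
qed

lemma ends_in_cases:
  assumes "br_execution r T R"
  obtains ex ey a where "ends_in_bishop r T R ex ey a" | ex ey where "ends_in_rook r T R ex ey"
proof -
  obtain n where n: "phases R = Suc n" using br_executionD(3)[OF assms] gr0_conv_Suc by blast
  then show ?thesis
    using that assms unfolding ends_in_bishop_def ends_in_rook_def by (cases "even n") blast+
qed

lemma switch_to_rook:
  assumes b: "ends_in_bishop r T R ex ey a" and eq: "server R T = r T"
    and ex': "ex' \<in> {ex, - ex}" and off: "offset R T = - (norm (offset R T) *\<^sub>R ex')"
  obtains R' where "ends_in_rook r T R' ex' ey"
proof -
  from b obtain n where n: "br_execution r T R" "phases R = Suc n" "even n" "xaxis R n = ex" "yaxis R n = ey"
    "axes ex ey" by (rule ends_in_bishopE)
  have ax: "axes ex' ey" using n(6) ex' unfolding axes_def by auto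
  have "rook_phase r (server R) (offset R) ex' ey T T"
    unfolding rook_phase_alt using eq off by (auto intro!: rook_movesI)
  then have "br_execution r T (R\<lparr>phases := Suc (Suc n), times := (times R)(Suc (Suc n) := T),
      xaxis := (xaxis R)(Suc n := ex'), yaxis := (yaxis R)(Suc n := ey)\<rparr>)"
    using n eq ex' by (intro append_phase ax) auto
  then show ?thesis using that n(3) unfolding ends_in_rook_def by fastforce
qed

text \<open>At the end of a rook phase the server is level with the request and on its
  \<open>- ex\<close> side. Taking \<open>- ex\<close> as the new upward direction therefore gives
  the server a nonnegative height. The same choice is made if the two coincide, and the bound on the
  number of phases relies on it.\<close>

lemma switch_to_bishop:
  assumes b: "ends_in_rook r T R ex ey" and off: "offset R T = 0"
  obtains R' where "ends_in_bishop r T R' ey (- ex) T"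
proof -
  from b obtain n where n: "br_execution r T R" "phases R = Suc n" "odd n"
    "times R n \<le> T" "axes ex ey" "rook_phase r (server R) (offset R) ex ey (times R n) T"
    by (rule ends_in_rookE)
  have ax: "axes ey (- ex)" using n(5) unfolding axes_def by (auto simp: inner_commute)
  have "T \<in> {times R n..T}" using n(4) by simp
  note D = rook_phaseD(1,2)[OF n(6) this]
  have "bishop_phase r (server R) (offset R) ey (- ex) T T"
    unfolding bishop_phase_def using D off by (auto simp: inner_diff_left)
  then have "br_execution r T (R\<lparr>phases := Suc (Suc n), times := (times R)(Suc (Suc n) := T),
      xaxis := (xaxis R)(Suc n := ey), yaxis := (yaxis R)(Suc n := - ex)\<rparr>)"
    using n off by (intro append_phase ax) auto
  then show ?thesis using that n(2,3) br_executionD(5)[OF n(1)] unfolding ends_in_bishop_def by fastforce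
qed

section \<open>Phases during a request of constant velocity\<close>

definition affine_on :: "(real \<Rightarrow> point) \<Rightarrow> point \<Rightarrow> real \<Rightarrow> real \<Rightarrow> bool" where
  "affine_on r d a b \<longleftrightarrow> (\<forall>u\<in>{a..b}. \<forall>v\<in>{a..b}. r v = r u + (v - u) *\<^sub>R d)"

lemma affine_on_inner:
  assumes "affine_on r d a b" "u \<in> {a..b}" "v \<in> {a..b}"
  shows "r v \<bullet> e = r u \<bullet> e + (v - u) * (d \<bullet> e)"
proof -
  have "r v = r u + (v - u) *\<^sub>R d" using assms unfolding affine_on_def by blast
  then have "r v \<bullet> e = (r u + (v - u) *\<^sub>R d) \<bullet> e" by (rule arg_cong)
  then show ?thesis by (simp add: inner_add_left)
qed

lemma affine_on_subinterval: "affine_on r d a b \<Longrightarrow> a \<le> a' \<Longrightarrow> b' \<le> b \<Longrightarrow> affine_on r d a' b'"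
  unfolding affine_on_def by auto

lemma continuous_on_concat:
  fixes f g :: "real \<Rightarrow> 'a::topological_space"
  assumes "continuous_on {a..b} f" "continuous_on {b..c} g" "a \<le> b" "b \<le> c" "f b = g b"
  shows "continuous_on {a..c} (\<lambda>t. if t \<le> b then f t else g t)"
proof -
  have "{a..c} = {a..b} \<union> {b..c}" using assms by auto
  moreover have "continuous_on ({a..b} \<union> {b..c}) (\<lambda>t. if t \<le> b then f t else g t)"
    using assms by (intro continuous_on_cases) auto
  ultimately show ?thesis by simp
qed

text \<open>The server gets constant velocity, and its height above the request falls at the
  constant rate \<open>\<bar>d \<bullet> ex\<bar> + d \<bullet> ey\<close>. So the server stays
  above on the whole interval if it does so at both ends.\<close>

lemma bishop_extend:
  assumes b: "ends_in_bishop r T R ex ey a" and apart: "server R T \<noteq> r T \<or> a = T"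
    and r: "unit_affine r" and step: "unit_step T T'" and d: "affine_on r d T T'"
    and above: "(T' - T) * (\<bar>d \<bullet> ex\<bar> + d \<bullet> ey) \<le> server R T \<bullet> ey - r T \<bullet> ey"
  obtains R' where "ends_in_bishop r T' R' ex ey a"
    "offset R' T' = offset R T - ((T' - T) * (d \<bullet> ex)) *\<^sub>R ex"
    "server R' T' \<bullet> ey - r T' \<bullet> ey
      = server R T \<bullet> ey - r T \<bullet> ey - (T' - T) * (\<bar>d \<bullet> ex\<bar> + d \<bullet> ey)"
proof -
  from b obtain n where R: "br_execution r T R"
    and n: "phases R = Suc n" "even n" "xaxis R n = ex" "yaxis R n = ey" "times R n = a"
    and a: "0 \<le> a" "a \<le> T" and ax: "axes ex ey"
    and ph: "bishop_phase r (server R) (offset R) ex ey a T"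
    by (rule ends_in_bishopE)
  have TT: "T \<le> T'" by (rule unit_step_le[OF step])
  note PD = bishop_phaseD[OF ph]
  define s where "s t = (if t \<le> T then server R t
    else server R T + (t - T) *\<^sub>R ((d \<bullet> ex) *\<^sub>R ex - \<bar>d \<bullet> ex\<bar> *\<^sub>R ey))" for t
  define off where "off t = (if t \<le> T then offset R t
    else offset R T - ((t - T) * (d \<bullet> ex)) *\<^sub>R ex)" for t
  have new: "s t = server R T + (t - T) *\<^sub>R ((d \<bullet> ex) *\<^sub>R ex - \<bar>d \<bullet> ex\<bar> *\<^sub>R ey)"
    "off t = offset R T - ((t - T) * (d \<bullet> ex)) *\<^sub>R ex" if "T \<le> t" for t
    using that by (auto simp: s_def off_def)
  have sxy: "s t \<bullet> ex = server R T \<bullet> ex + (t - T) * (d \<bullet> ex)"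
    "s t \<bullet> ey = server R T \<bullet> ey - (t - T) * \<bar>d \<bullet> ex\<bar>" if "T \<le> t" for t
    unfolding new[OF that] using ax by (simp_all add: inner_simps)
  have rxy: "r t \<bullet> e = r T \<bullet> e + (t - T) * (d \<bullet> e)" if "t \<in> {T..T'}" for t e
    using affine_on_inner[OF d _ that, of T] TT by simp
  have gap: "s t \<bullet> ey - r t \<bullet> ey = server R T \<bullet> ey - r T \<bullet> ey - (t - T) * (\<bar>d \<bullet> ex\<bar> + d \<bullet> ey)"
    if "t \<in> {T..T'}" for t
    using sxy(2)[of t] rxy[OF that, of ey] that by (simp add: ring_distribs)
  have T: "T \<in> {a..T}" using a by simp
  have old: "s t = server R t" "off t = offset R t" if "t \<le> T" for t
    using that by (auto simp: s_def off_def)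
  have gap0: "0 \<le> server R T \<bullet> ey - r T \<bullet> ey" using PD(3)[OF T] by simp
  have gap_nonneg: "r t \<bullet> ey \<le> s t \<bullet> ey" if t: "t \<in> {T..T'}" for t
  proof -
    have "(t - T) * (\<bar>d \<bullet> ex\<bar> + d \<bullet> ey) \<le> server R T \<bullet> ey - r T \<bullet> ey"
    proof (cases "0 \<le> \<bar>d \<bullet> ex\<bar> + d \<bullet> ey")
      case True
      then have "(t - T) * (\<bar>d \<bullet> ex\<bar> + d \<bullet> ey) \<le> (T' - T) * (\<bar>d \<bullet> ex\<bar> + d \<bullet> ey)"
        using t by (intro mult_right_mono) auto
      then show ?thesis using above by simp
    next
      case False
      then have "(t - T) * (\<bar>d \<bullet> ex\<bar> + d \<bullet> ey) \<le> 0" using t by (intro mult_nonneg_nonpos) auto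
      then show ?thesis using gap0 by simp
    qed
    then show ?thesis using gap[OF t] by simp
  qed
  have phase: "bishop_phase r s off ex ey a T'"
    unfolding bishop_phase_def
  proof (rule conjI; intro ballI impI)
    fix t assume t: "t \<in> {a..T'}"
    show "s t \<bullet> ex = r t \<bullet> ex \<and> s t \<bullet> ey = s a \<bullet> ey - curve_length dist (\<lambda>u. r u \<bullet> ex) a t \<and>
        r t \<bullet> ey \<le> s t \<bullet> ey \<and> off t = - (((s t - r a) \<bullet> ex) *\<^sub>R ex)"
    proof (cases "t \<le> T")
      case True
      then show ?thesis using PD[of t] t old a by simp
    next
      case False
      then have t': "t \<in> {T..T'}" "T \<le> t" using t by auto
      have "curve_length dist (\<lambda>u. r u \<bullet> ex) a t
          = curve_length dist (\<lambda>u. r u \<bullet> ex) a T + \<bar>r t \<bullet> ex - r T \<bullet> ex\<bar>"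
        by (rule piecewise_monotone_curve_length[of a t])
          (use a t' TT unit_affine_monotone[OF r] unit_step_sub[OF step, of T t] in auto)
      moreover have "\<bar>r t \<bullet> ex - r T \<bullet> ex\<bar> = (t - T) * \<bar>d \<bullet> ex\<bar>"
        using t' by (simp add: rxy[OF t'(1)] abs_mult)
      ultimately have "s t \<bullet> ey = s a \<bullet> ey - curve_length dist (\<lambda>u. r u \<bullet> ex) a t"
        using sxy(2)[OF t'(2)] PD(2)[OF T] old(1)[OF a(2)] by simp
      moreover have "s t \<bullet> ex = r t \<bullet> ex"
        using sxy(1)[OF t'(2)] rxy[OF t'(1), of ex] PD(1)[OF T] by simp
      moreover have "off t = - (((s t - r a) \<bullet> ex) *\<^sub>R ex)"
        unfolding new(2)[OF t'(2)] PD(4)[OF T] inner_diff_left sxy(1)[OF t'(2)]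
        by (simp add: algebra_simps)
      ultimately show ?thesis using gap_nonneg[OF t'(1)] by simp
    qed
  next
    fix t u assume t: "t \<in> {a<..<T'}" "s t = r t" and u: "u \<in> {a..t}"
    show "s u = r u"
    proof (cases "t < T")
      case True
      then have "server R u = r u"
        using bishop_phase_meet[OF ph, of t u] t u old(1)[of t] by simp
      then show ?thesis using u True old(1)[of u] by simp
    next
      case False
      then have t': "t \<in> {T..T'}" "T \<le> t" using t by auto
      \<comment> \<open>A coincidence strictly before \<open>T'\<close> excludes \<kappa> > 0, since
        otherwise the height would be negative at \<open>T'\<close>. As the height is nonnegative at
        \<open>T\<close>, it must already be 0 there; then \<open>apart\<close> gives
        \<open>a = T\<close> and the height is constantly 0, so the two have coincided since the
        start of the phase.\<close>
      define \<kappa> g where "\<kappa> = \<bar>d \<bullet> ex\<bar> + d \<bullet> ey" and "g = server R T \<bullet> ey - r T \<bullet> ey"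
      have z: "g = (t - T) * \<kappa>" using gap[OF t'(1)] t(2) by (simp add: \<kappa>_def g_def)
      have "(T' - T) * \<kappa> \<le> (t - T) * \<kappa>" using above z by (simp add: \<kappa>_def g_def)
      then have "\<kappa> \<le> 0" using t by (simp add: mult_le_cancel_right)
      moreover have "0 \<le> (t - T) * \<kappa>" using gap0 z by (simp add: g_def)
      ultimately have "(t - T) * \<kappa> = 0" using t'(2) by (auto simp: zero_le_mult_iff)
      then have "g = 0" and tk: "t = T \<or> \<kappa> = 0" using z by auto
      then have "server R T = r T" using PD(1)[OF T] by (simp add: point_eq_axes[OF ax] g_def)
      then have "a = T" using apart by simp
      then have "\<kappa> = 0" using tk t by auto
      have u': "u \<in> {T..T'}" "T \<le> u" using u t \<open>a = T\<close> by auto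
      have "s u \<bullet> ey = r u \<bullet> ey" using gap[OF u'(1)] \<open>\<kappa> = 0\<close> \<open>g = 0\<close> by (simp add: \<kappa>_def g_def)
      moreover have "s u \<bullet> ex = r u \<bullet> ex"
        using sxy(1)[OF u'(2)] rxy[OF u'(1), of ex] PD(1)[OF T] by simp
      ultimately show ?thesis by (simp add: point_eq_axes[OF ax])
    qed
  qed
  have "0 \<le> T" using a by simp
  have cont: "continuous_on {0..T'} s" unfolding s_def
    using br_executionD(1)[OF R] TT \<open>0 \<le> T\<close>
    by (intro continuous_on_concat continuous_intros) auto
  define R' where "R' = R\<lparr>times := (times R)(Suc n := T'), server := s, offset := off\<rparr>"
  have "br_execution r T' R'" unfolding R'_def
    by (rule extend_execution[OF R n(1) TT old cont]) (use phase n in auto)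
  then have "ends_in_bishop r T' R' ex ey a"
    using n unfolding ends_in_bishop_def R'_def by auto
  then show ?thesis using that[of R'] new(2)[OF TT] gap[of T'] TT by (simp add: R'_def)
qed

text \<open>The height is affine in time, so the phase either lasts until \<open>E\<close> or ends
  at an explicit time.\<close>

lemma bishop_run:
  assumes b: "ends_in_bishop r T R ex ey a" and apart: "server R T \<noteq> r T \<or> a = T"
    and r: "unit_affine r" and step: "unit_step T E" and d: "affine_on r d T E"
  obtains T' R' where "T \<le> T'" "T' \<le> E" "ends_in_bishop r T' R' ex ey a"
    "offset R' T' = offset R T - ((T' - T) * (d \<bullet> ex)) *\<^sub>R ex" "T' = E \<or> server R' T' = r T'"
proof -
  from b obtain n where a: "0 \<le> a" "a \<le> T" and ax: "axes ex ey"
    and ph: "bishop_phase r (server R) (offset R) ex ey a T"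
    by (rule ends_in_bishopE)
  have TE: "T \<le> E" by (rule unit_step_le[OF step])
  define \<kappa> g where "\<kappa> = \<bar>d \<bullet> ex\<bar> + d \<bullet> ey" and "g = server R T \<bullet> ey - r T \<bullet> ey"
  have g: "0 \<le> g" using bishop_phaseD(3)[OF ph, of T] a by (simp add: g_def)
  show ?thesis
  proof (cases "(E - T) * \<kappa> \<le> g")
    case True
    then obtain R' where "ends_in_bishop r E R' ex ey a"
      "offset R' E = offset R T - ((E - T) * (d \<bullet> ex)) *\<^sub>R ex"
      using bishop_extend[OF b apart r step d] by (auto simp: \<kappa>_def g_def)
    then show ?thesis using that[of E R'] TE by simp
  next
    case False
    then have "0 < (E - T) * \<kappa>" using g by simp
    then have \<kappa>: "0 < \<kappa>" using TE by (simp add: zero_less_mult_iff)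
    \<comment> \<open>The time at which the height reaches 0. If the phase starts with a
      coincidence, this is \<open>T\<close> itself and the phase has duration zero.\<close>
    define T' where "T' = T + g / \<kappa>"
    have T': "T \<le> T'" "T' \<le> E" using False g \<kappa> by (simp_all add: T'_def field_simps)
    have eq: "(T' - T) * \<kappa> = g" using \<kappa> by (simp add: T'_def)
    have "unit_step T T'" using unit_step_sub[OF step, of T T'] T' by simp
    moreover have "affine_on r d T T'" using affine_on_subinterval[OF d, of T T'] T' by simp
    ultimately obtain R' where R': "ends_in_bishop r T' R' ex ey a"
      "offset R' T' = offset R T - ((T' - T) * (d \<bullet> ex)) *\<^sub>R ex"
      "server R' T' \<bullet> ey - r T' \<bullet> ey = g - (T' - T) * \<kappa>"
      using bishop_extend[OF b apart r] eq unfolding \<kappa>_def g_def by (metis order_refl)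
    have "server R' T' \<bullet> ex = r T' \<bullet> ex"
      using R'(1) by (rule ends_in_bishopE) (auto dest: bishop_phaseD(1)[where t = T'])
    then have "server R' T' = r T'" using R'(3) eq by (simp add: point_eq_axes[OF ax])
    then show ?thesis using that[OF T' R'(1,2)] by simp
  qed
qed

text \<open>Provides the end of a rook phase, with \<open>f\<close> the length of the offset. If
  \<open>f a = 0\<close>, then \<open>m = a\<close>: a rook phase entered with offset 0 ends at
  once.\<close>

lemma first_zero:
  fixes f :: "real \<Rightarrow> real"
  assumes "continuous_on {a..b} f" "a \<le> b" "0 \<le> f a"
  obtains m where "a \<le> m" "m \<le> b" "\<And>t. t \<in> {a..<m} \<Longrightarrow> 0 < f t" "0 \<le> f m" "m = b \<or> f m = 0"
proof (cases "\<forall>t\<in>{a..b}. 0 < f t")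
  case True
  then show ?thesis using that[of b] assms(2) by (simp add: less_imp_le)
next
  case False
  define Z where "Z = {t \<in> {a..b}. f t = 0}"
  have zero: "\<exists>z\<in>Z. z \<le> t" if "t \<in> {a..b}" "f t \<le> 0" for t
    using IVT2'[of f t 0 a] assms that continuous_on_subset[OF assms(1), of "{a..t}"]
    by (fastforce simp: Z_def)
  have "closed Z" unfolding Z_def
    by (rule continuous_closed_preimage_constant[OF assms(1)]) simp
  moreover have "Z \<noteq> {}" using False zero by (fastforce simp: not_less)
  moreover have bdd: "bdd_below Z" by (auto simp: Z_def intro!: bdd_belowI)
  ultimately have m: "Inf Z \<in> Z" using closed_contains_Inf by blast
  have "0 < f t" if "t \<in> {a..<Inf Z}" for t
  proof (rule ccontr)
    assume "\<not> 0 < f t"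
    moreover have "t \<in> {a..b}" using that m by (auto simp: Z_def)
    ultimately obtain z where "z \<in> Z" "z \<le> t" using zero[of t] by auto
    then show False using cInf_lower[OF _ bdd, of z] that by auto
  qed
  then show ?thesis using that[of "Inf Z"] m by (auto simp: Z_def)
qed

lemma antimono_on_append:
  fixes f :: "real \<Rightarrow> real"
  assumes "antimono_on {a..b} f" "antimono_on {b..c} f"
  shows "antimono_on {a..c} f"
proof (rule monotone_onI)
  fix x y assume xy: "x \<in> {a..c}" "y \<in> {a..c}" "x \<le> y"
  consider "y \<le> b" | "b \<le> x" | "x \<le> b" "b \<le> y" by linarith
  then show "f y \<le> f x"
  proof cases
    case 1
    then show ?thesis using monotone_onD[OF assms(1), of x y] xy by simp
  next
    case 2
    then show ?thesis using monotone_onD[OF assms(2), of x y] xy by simp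
  next
    case 3
    then show ?thesis using monotone_onD[OF assms(1), of x b] monotone_onD[OF assms(2), of b y] xy by simp
  qed
qed

text \<open>The server rests at \<open>S\<close> until the request, coming from the right, takes it
  along. Since the request is monotone on the segment, this motion is the minimum of
  \<open>S\<close> and the current coordinate of the request, with no memory of the past.\<close>

lemma rook_moves_affine:
  assumes d: "affine_on r d a b" and s: "\<And>t. t \<in> {a..b} \<Longrightarrow> s t \<bullet> ex = min S (r t \<bullet> ex)"
    and S: "S \<le> r a \<bullet> ex"
  shows "rook_moves r s ex a b"
proof (rule rook_movesI)
  fix u v assume uv: "a \<le> u" "u < v" "v \<le> b"
  define c where "c = d \<bullet> ex"
  have r: "r t \<bullet> ex = r a \<bullet> ex + (t - a) * c" if "t \<in> {a..b}" for t
    using affine_on_inner[OF d _ that, of a] uv by (simp add: c_def)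
  have in_ab: "u \<in> {a..b}" "v \<in> {a..b}" using uv by auto
  have slope: "r v \<bullet> ex - r u \<bullet> ex = (v - u) * c"
    using affine_on_inner[OF d in_ab] by (simp add: c_def)
  have still: "s v \<bullet> ex = s u \<bullet> ex" if "0 \<le> c"
  proof -
    have "0 \<le> (u - a) * c" "0 \<le> (v - a) * c" using that uv by auto
    then have "S \<le> r u \<bullet> ex" "S \<le> r v \<bullet> ex" using r[OF in_ab(1)] r[OF in_ab(2)] S by linarith+
    then show ?thesis using s[OF in_ab(1)] s[OF in_ab(2)] by simp
  qed
  show "s v \<bullet> ex = s u \<bullet> ex" if left: "\<And>t. t \<in> {u<..<v} \<Longrightarrow> s t \<bullet> ex < r t \<bullet> ex"
  proof (cases "0 \<le> c")
    case False
    then have c: "0 < - c" by simp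
    \<comment> \<open>The right-hand side is the time at which the request reaches \<open>S\<close>.
      Separation is assumed on the open interval only, and the bound passes to \<open>v\<close> by
      density.\<close>
    have "t \<le> a + (r a \<bullet> ex - S) / (- c)" if "u < t" "t < v" for t
    proof -
      have "s t \<bullet> ex < r t \<bullet> ex" "s t \<bullet> ex = min S (r t \<bullet> ex)" "r t \<bullet> ex = r a \<bullet> ex + (t - a) * c"
        using left[of t] s[of t] r[of t] that uv by auto
      then have "(t - a) * (- c) \<le> r a \<bullet> ex - S" by simp
      then have "t - a \<le> (r a \<bullet> ex - S) / (- c)" unfolding pos_le_divide_eq[OF c] .
      then show ?thesis by simp
    qed
    then have "v \<le> a + (r a \<bullet> ex - S) / (- c)" by (rule dense_le_bounded[OF uv(2)])
    then have "v - a \<le> (r a \<bullet> ex - S) / (- c)" by simp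
    then have "(v - a) * (- c) \<le> r a \<bullet> ex - S" unfolding pos_le_divide_eq[OF c] .
    then have "S \<le> r v \<bullet> ex" using r[OF in_ab(2)] by simp
    moreover have "(v - u) * c \<le> 0" using False uv by (intro mult_nonneg_nonpos) auto
    ultimately show ?thesis using slope s[OF in_ab(1)] s[OF in_ab(2)] by simp
  qed (rule still)
  show "s v \<bullet> ex = s u \<bullet> ex" if "mono_on {u..v} (\<lambda>t. r t \<bullet> ex)"
  proof (rule still)
    have "r u \<bullet> ex \<le> r v \<bullet> ex" using monotone_onD[OF that, of u v] uv by simp
    then have "0 \<le> (v - u) * c" using slope by simp
    then show "0 \<le> c" using uv by (simp add: zero_le_mult_iff)
  qed
  show "s v \<bullet> ex = r v \<bullet> ex" if "s u \<bullet> ex = r u \<bullet> ex" "antimono_on {u..v} (\<lambda>t. r t \<bullet> ex)"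
    using monotone_onD[OF that(2), of u v] that(1) uv s[OF in_ab(1)] s[OF in_ab(2)] by simp
qed

text \<open>\<open>w\<close> is the length of the offset along the explicit motion: the vertical
  distance counts \<open>1 + sqrt 3\<close> times, and the maximum is how far the server has been
  taken to the left.\<close>

lemma rook_extend:
  assumes b: "ends_in_rook r T R ex ey"
    and r: "unit_affine r" and step: "unit_step T T'" and d: "affine_on r d T T'"
  defines "w \<equiv> \<lambda>t. norm (offset R T) - (1 + sqrt 3) * ((t - T) * \<bar>d \<bullet> ey\<bar>)
    - max 0 (server R T \<bullet> ex - r t \<bullet> ex)"
  assumes pos: "\<And>t. t \<in> {T..<T'} \<Longrightarrow> 0 < w t" and nonneg: "0 \<le> w T'"
  obtains R' where "ends_in_rook r T' R' ex ey" "norm (offset R' T') = w T'"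
proof -
  from b obtain n where R: "br_execution r T R"
    and n: "phases R = Suc n" "odd n" "xaxis R n = ex" "yaxis R n = ey"
    and a': "0 \<le> times R n" "times R n \<le> T" and ax: "axes ex ey"
    and ph': "rook_phase r (server R) (offset R) ex ey (times R n) T"
    by (rule ends_in_rookE)
  define a where "a = times R n"
  have a: "0 \<le> a" "a \<le> T" and ph: "rook_phase r (server R) (offset R) ex ey a T"
    using a' ph' by (simp_all add: a_def)
  have TT: "T \<le> T'" by (rule unit_step_le[OF step])
  note PD = rook_phaseD[OF ph]
  have T: "T \<in> {a..T}" using a by simp
  define S where "S = server R T \<bullet> ex"
  have S: "S \<le> r T \<bullet> ex" using PD(2)[OF T] by (simp add: S_def)
  define s where "s t = (if t \<le> T then server R t
    else server R T + (min S (r t \<bullet> ex) - S) *\<^sub>R ex + ((t - T) * (d \<bullet> ey)) *\<^sub>R ey)" for t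
  define off where "off t = (if t \<le> T then offset R t else - (w t *\<^sub>R ex))" for t
  have wT: "w T = norm (offset R T)" using S by (simp add: w_def S_def)
  have old: "s t = server R t" "off t = offset R t" if "t \<le> T" for t
    using that by (auto simp: s_def off_def)
  have new: "s t = server R T + (min S (r t \<bullet> ex) - S) *\<^sub>R ex + ((t - T) * (d \<bullet> ey)) *\<^sub>R ey"
    "off t = - (w t *\<^sub>R ex)" if "T \<le> t" for t
    using that S PD(3)[OF T] wT by (auto simp: s_def off_def)
  have rxy: "r t \<bullet> e = r T \<bullet> e + (t - T) * (d \<bullet> e)" if "t \<in> {T..T'}" for t e
    using affine_on_inner[OF d _ that, of T] TT by simp
  have sx: "s t \<bullet> ex = min S (r t \<bullet> ex)" if "T \<le> t" for t
    unfolding new(1)[OF that] using ax by (simp add: inner_simps S_def)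
  have sy: "s t \<bullet> ey = r t \<bullet> ey" if t: "t \<in> {T..T'}" for t
  proof -
    have "s t \<bullet> ey = server R T \<bullet> ey + (t - T) * (d \<bullet> ey)"
      using new(1)[of t] t ax by (simp add: inner_simps)
    then show ?thesis using rxy[OF t, of ey] PD(1)[OF T] by simp
  qed
  have sub: "unit_step u v" if "T \<le> u" "u \<le> v" "v \<le> T'" for u v
    using unit_step_sub[OF step that] .
  have anti_new: "antimono_on {T..T'} (\<lambda>t. s t \<bullet> ex)"
  proof (rule monotone_onI)
    fix x y assume xy: "x \<in> {T..T'}" "y \<in> {T..T'}" "x \<le> y"
    show "s y \<bullet> ex \<le> s x \<bullet> ex"
    proof (cases "0 \<le> d \<bullet> ex")
      case True
      then have "S \<le> r x \<bullet> ex" using S rxy[OF xy(1), of ex] xy by (smt (verit) atLeastAtMost_iff mult_nonneg_nonneg)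
      then show ?thesis using sx[of x] sx[of y] xy by simp
    next
      case False
      then have "r y \<bullet> ex \<le> r x \<bullet> ex"
        using rxy[OF xy(1), of ex] rxy[OF xy(2), of ex] xy by (simp add: mult_right_mono_neg)
      then show ?thesis using sx[of x] sx[of y] xy by auto
    qed
  qed
  have cont_old: "continuous_on {a..T} (server R)"
    using br_executionD(1)[OF R] a by (auto intro: continuous_on_subset)
  \<comment> \<open>A unit step may contain \<open>T\<close> in its interior, because the phase may
    have begun on the same segment. So the old and the new part of the motion must be
    joined.\<close>
  have anti: "antimono_on {u..v} (\<lambda>t. s t \<bullet> ex)" if uv: "a \<le> u" "v \<le> T'" "unit_step u v" for u v
  proof -
    have old_anti: "antimono_on {u..v'} (\<lambda>t. s t \<bullet> ex)" if "v' \<le> T" "v' \<le> v" for v'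
    proof (cases "u \<le> v'")
      case True
      have "antimono_on {u..v'} (\<lambda>t. server R t \<bullet> ex)"
        using rook_phase_antimono[OF r ph cont_old uv(1) that(1)] unit_step_sub[OF uv(3) _ True that(2)]
        by simp
      then show ?thesis using that old(1) by (simp add: monotone_on_def)
    qed (simp add: monotone_on_def)
    consider "v \<le> T" | "T \<le> u" | "u < T" "T < v" by linarith
    then show ?thesis
    proof cases
      case 1
      then show ?thesis using old_anti[of v] by simp
    next
      case 2
      then show ?thesis using uv by (intro monotone_on_subset[OF anti_new]) auto
    next
      case 3
      have "antimono_on {T..v} (\<lambda>t. s t \<bullet> ex)" using uv by (intro monotone_on_subset[OF anti_new]) auto
      with old_anti[of T] 3 show ?thesis by (auto intro: antimono_on_append[of u T])
    qed
  qed
  have sy_all: "s t \<bullet> ey = r t \<bullet> ey" if "t \<in> {a..T'}" for t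
  proof (cases "t \<le> T")
    case True
    then show ?thesis using PD(1)[of t] old(1)[OF True] that by simp
  next
    case False
    then show ?thesis using sy[of t] that by simp
  qed
  have phase: "rook_phase r s off ex ey a T'"
    unfolding rook_phase_alt
  proof (intro conjI)
    have "s t \<bullet> ex \<le> r t \<bullet> ex" if "t \<in> {a..T'}" for t
    proof (cases "t \<le> T")
      case True
      then show ?thesis using PD(2)[of t] old(1)[OF True] that by simp
    next
      case False
      then show ?thesis using sx[of t] by simp
    qed
    then show "\<forall>t\<in>{a..T'}. s t \<bullet> ey = r t \<bullet> ey \<and> s t \<bullet> ex \<le> r t \<bullet> ex" using sy_all by blast
    have "rook_moves r (server R) ex a T" using ph unfolding rook_phase_alt by blast
    then have "rook_moves r s ex a T" by (rule rook_moves_cong) (simp add: old(1))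
    moreover have "rook_moves r s ex T T'"
      using sx by (intro rook_moves_affine[OF d _ S]) simp
    ultimately show "rook_moves r s ex a T'" by (rule rook_moves_append)
    show "\<forall>t\<in>{a..<T'}. off t \<noteq> 0"
    proof
      fix t assume t: "t \<in> {a..<T'}"
      show "off t \<noteq> 0"
      proof (cases "t < T")
        case True
        then show ?thesis using ph t old(2)[of t] unfolding rook_phase_alt by simp
      next
        case False
        then have "off t = - (w t *\<^sub>R ex)" "0 < w t" using new(2) pos t by auto
        moreover have "ex \<noteq> 0" using axes_inner(5)[OF ax] by auto
        ultimately show ?thesis by simp
      qed
    qed
    show "\<forall>t\<in>{a..T'}. off t = - (norm (off t) *\<^sub>R ex) \<and>
        norm (off t) = norm (off a) - (1 + sqrt 3) * curve_length dist (\<lambda>u. s u \<bullet> ey) a t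
          - curve_length dist (\<lambda>u. s u \<bullet> ex) a t"
    proof
      have len: "curve_length dist (\<lambda>u. s u \<bullet> e) a t = curve_length dist (\<lambda>u. server R u \<bullet> e) a t"
        if "t \<le> T" for t e
        using old(1) that by (intro dist_length.curve_length_cong) simp
      fix t assume t: "t \<in> {a..T'}"
      show "off t = - (norm (off t) *\<^sub>R ex) \<and>
        norm (off t) = norm (off a) - (1 + sqrt 3) * curve_length dist (\<lambda>u. s u \<bullet> ey) a t
          - curve_length dist (\<lambda>u. s u \<bullet> ex) a t"
      proof (cases "t \<le> T")
        case True
        then have "t \<in> {a..T}" using t by simp
        then show ?thesis using PD(3,4)[of t] unfolding old(2)[OF True] old(2)[OF a(2)] len[OF True] by blast
      next
        case False
        then have t': "t \<in> {T..T'}" "T \<le> t" using t by auto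
        have mono_y: "monotone_fun (\<lambda>t. s t \<bullet> ey) u v" if "a \<le> u" "v \<le> t" "unit_step u v" for u v
        proof -
          have "\<forall>x\<in>{u..v}. s x \<bullet> ey = r x \<bullet> ey" using sy_all that t by simp
          then show ?thesis using unit_affine_monotone[OF r that(3), of ey] by (simp add: monotone_on_def)
        qed
        have "curve_length dist (\<lambda>t. s t \<bullet> ey) a t
            = curve_length dist (\<lambda>t. s t \<bullet> ey) a T + \<bar>s t \<bullet> ey - s T \<bullet> ey\<bar>"
          using a t' sub by (intro piecewise_monotone_curve_length[of a t] mono_y) auto
        moreover have "\<bar>s t \<bullet> ey - s T \<bullet> ey\<bar> = (t - T) * \<bar>d \<bullet> ey\<bar>"
          using sy[OF t'(1)] sy[of T] TT rxy[OF t'(1), of ey] t' by (simp add: abs_mult)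
        moreover have "curve_length dist (\<lambda>t. s t \<bullet> ex) a t
            = curve_length dist (\<lambda>t. s t \<bullet> ex) a T + \<bar>s t \<bullet> ex - s T \<bullet> ex\<bar>"
          using a t' sub anti by (intro piecewise_monotone_curve_length[of a t]) auto
        moreover have "\<bar>s t \<bullet> ex - s T \<bullet> ex\<bar> = max 0 (server R T \<bullet> ex - r t \<bullet> ex)"
          using sx[OF t'(2)] old(1)[of T] by (simp add: S_def)
        moreover note PD(4)[OF T]
        moreover have "0 \<le> w t" using pos[of t] nonneg t' by (cases "t = T'") auto
        then have "norm (off t) = w t" using new(2)[OF t'(2)] ax by simp
        ultimately show ?thesis
          unfolding new(2)[OF t'(2)] old(2)[OF a(2)] len[OF order_refl] by (simp add: w_def ring_distribs)
      qed
    qed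
  qed
  have "0 \<le> T" using a by simp
  have cont: "continuous_on {0..T'} s" unfolding s_def
    using br_executionD(1)[OF R] TT \<open>0 \<le> T\<close> S
    by (intro continuous_on_concat continuous_intros unit_affine_continuous[OF r step]) auto
  define R' where "R' = R\<lparr>times := (times R)(Suc n := T'), server := s, offset := off\<rparr>"
  have "br_execution r T' R'" unfolding R'_def
    by (rule extend_execution[OF R n(1) TT old cont]) (use phase n in \<open>auto simp: a_def\<close>)
  then have "ends_in_rook r T' R' ex ey" using n unfolding ends_in_rook_def R'_def by auto
  moreover have "norm (offset R' T') = w T'" using new(2)[OF TT] nonneg ax by (simp add: R'_def)
  ultimately show ?thesis by (rule that)
qed

lemma rook_run:
  assumes b: "ends_in_rook r T R ex ey"
    and r: "unit_affine r" and step: "unit_step T E" and d: "affine_on r d T E"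
  obtains T' R' where "T \<le> T'" "T' \<le> E" "ends_in_rook r T' R' ex ey" "T' = E \<or> offset R' T' = 0"
proof -
  from b obtain n where a: "times R n \<le> T" and ax: "axes ex ey"
    and ph: "rook_phase r (server R) (offset R) ex ey (times R n) T"
    by (rule ends_in_rookE)
  define w where "w t = norm (offset R T) - (1 + sqrt 3) * ((t - T) * \<bar>d \<bullet> ey\<bar>)
    - max 0 (server R T \<bullet> ex - r t \<bullet> ex)" for t
  have TE: "T \<le> E" by (rule unit_step_le[OF step])
  have "continuous_on {T..E} w" unfolding w_def
    by (intro continuous_intros unit_affine_continuous[OF r step])
  moreover have "0 \<le> w T" using rook_phaseD(2)[OF ph, of T] a by (simp add: w_def)
  ultimately obtain T' where T': "T \<le> T'" "T' \<le> E" "\<And>t. t \<in> {T..<T'} \<Longrightarrow> 0 < w t" "0 \<le> w T'"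
    "T' = E \<or> w T' = 0"
    using first_zero[OF _ TE] by metis
  have "unit_step T T'" using unit_step_sub[OF step, of T T'] T' by simp
  moreover have "affine_on r d T T'" using affine_on_subinterval[OF d, of T T'] T' by simp
  ultimately obtain R' where "ends_in_rook r T' R' ex ey" "norm (offset R' T') = w T'"
    using rook_extend[OF b r] T'(3,4) unfolding w_def by metis
  then show ?thesis using that[OF T'(1,2)] T'(5) by auto
qed

text \<open>On a segment with velocity \<open>d\<close> only boundedly many phases occur. A rook phase that follows
  a bishop phase started on the segment has \<open>0 \<le> d \<bullet> ex\<close>, because the offset points against the
  motion, so the next bishop phase has \<open>d \<bullet> ey \<le> 0\<close>. It ends only if \<open>\<bar>d \<bullet> ey\<bar> < \<bar>d \<bullet> ex\<bar>\<close>, and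
  then the bishop phase after it has \<open>d \<bullet> ey \<le> - \<bar>d \<bullet> ex\<bar>\<close> and never ends.\<close>

locale segment =
  fixes r :: "real \<Rightarrow> point" and d :: point and A E :: real
  assumes r: "unit_affine r" and step: "unit_step A E" and d: "affine_on r d A E"
begin

definition completable :: bool where
  "completable \<longleftrightarrow> (\<exists>R. br_execution r E R)"

lemma sub: "T \<in> {A..E} \<Longrightarrow> unit_step T E" "T \<in> {A..E} \<Longrightarrow> affine_on r d T E"
  using unit_step_sub[OF step] affine_on_subinterval[OF d] by auto

lemma completable_bishop: "ends_in_bishop r E R ex ey a \<Longrightarrow> completable"
  unfolding completable_def ends_in_bishop_def by blast

lemma completable_rook: "ends_in_rook r E R ex ey \<Longrightarrow> completable"
  unfolding completable_def ends_in_rook_def by blast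

text \<open>Stated with a continuation, so that the possible successions of phases can be treated
  from the last phase backwards, each lemma knowing more about \<open>d\<close> than those after
  it.\<close>

lemma rook_then_bishop:
  assumes "ends_in_rook r T R ex ey" "T \<in> {A..E}"
    and continue: "\<And>T' R'. T' \<in> {A..E} \<Longrightarrow> ends_in_bishop r T' R' ey (- ex) T' \<Longrightarrow> completable"
  shows completable
proof -
  obtain T' R' where T': "T \<le> T'" "T' \<le> E" "ends_in_rook r T' R' ex ey" "T' = E \<or> offset R' T' = 0"
    by (rule rook_run[OF assms(1) r sub[OF assms(2)]])
  show ?thesis
  proof (cases "T' = E")
    case True
    then show ?thesis using completable_rook T' by blast
  next
    case False
    then obtain R'' where "ends_in_bishop r T' R'' ey (- ex) T'"
      using T' by (auto elim: switch_to_bishop)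
    then show ?thesis using continue[of T' R''] T' assms(2) by simp
  qed
qed

lemma new_bishop_then_rook:
  assumes b: "ends_in_bishop r T R ex ey T" and T: "T \<in> {A..E}"
    and continue: "\<And>T' R' ex'. T' \<in> {A..E} \<Longrightarrow> ends_in_rook r T' R' ex' ey \<Longrightarrow> d \<bullet> ex' = \<bar>d \<bullet> ex\<bar> \<Longrightarrow> completable"
  shows completable
proof -
  obtain T' R' where T': "T \<le> T'" "T' \<le> E" "ends_in_bishop r T' R' ex ey T"
    "offset R' T' = offset R T - ((T' - T) * (d \<bullet> ex)) *\<^sub>R ex" "T' = E \<or> server R' T' = r T'"
    by (rule bishop_run[OF b _ r sub[OF T]]) auto
  have ax: "axes ex ey" and off: "offset R T = 0"
    using b by (auto elim!: ends_in_bishopE intro: bishop_start_offset)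
  show ?thesis
  proof (cases "T' = E")
    case True
    then show ?thesis using completable_bishop T' by blast
  next
    case False
    \<comment> \<open>The phase began on this segment with offset 0, so its offset is a multiple of
      the horizontal velocity with the opposite sign. The x axis opposite to the offset therefore
      points along the motion.\<close>
    define ex' where "ex' = (if 0 \<le> d \<bullet> ex then ex else - ex)"
    have ex': "ex' \<in> {ex, - ex}" "d \<bullet> ex' = \<bar>d \<bullet> ex\<bar>" by (auto simp: ex'_def)
    have "offset R' T' = - (norm (offset R' T') *\<^sub>R ex')"
      unfolding T'(4) off using T'(1) ax by (simp add: ex'_def abs_mult)
    then obtain R'' where "ends_in_rook r T' R'' ex' ey"
      using T' False ex'(1) by (auto elim: switch_to_rook)
    then show ?thesis using continue[of T' R'' ex'] ex'(2) T' T by simp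
  qed
qed

lemma completable_receding_bishop:
  assumes b: "ends_in_bishop r T R ex ey T" and T: "T \<in> {A..E}" and "\<bar>d \<bullet> ex\<bar> \<le> - (d \<bullet> ey)"
  shows completable
proof -
  have ph: "bishop_phase r (server R) (offset R) ex ey T T" using b by (rule ends_in_bishopE)
  have "0 \<le> server R T \<bullet> ey - r T \<bullet> ey" using bishop_phaseD(3)[OF ph, of T] by simp
  moreover have "(E - T) * (\<bar>d \<bullet> ex\<bar> + d \<bullet> ey) \<le> 0" using assms by (intro mult_nonneg_nonpos) auto
  ultimately have above: "(E - T) * (\<bar>d \<bullet> ex\<bar> + d \<bullet> ey) \<le> server R T \<bullet> ey - r T \<bullet> ey" by linarith
  obtain R' where "ends_in_bishop r E R' ex ey T"
    by (rule bishop_extend[OF b _ r sub[OF T] above]) simp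
  then show ?thesis by (rule completable_bishop)
qed

lemma completable_fast_rook:
  assumes "ends_in_rook r T R ex ey" "T \<in> {A..E}" "\<bar>d \<bullet> ey\<bar> \<le> d \<bullet> ex"
  shows completable
  by (rule rook_then_bishop[OF assms(1,2)], rule completable_receding_bishop) (use assms(3) in auto)

lemma completable_away_bishop:
  assumes b: "ends_in_bishop r T R ex ey T" and T: "T \<in> {A..E}" and "d \<bullet> ey \<le> 0"
  shows completable
proof (cases "\<bar>d \<bullet> ex\<bar> \<le> - (d \<bullet> ey)")
  case True
  then show ?thesis using completable_receding_bishop[OF b T] by simp
next
  case False
  then have le: "\<bar>d \<bullet> ey\<bar> \<le> \<bar>d \<bullet> ex\<bar>" using \<open>d \<bullet> ey \<le> 0\<close> by simp
  show ?thesis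
    by (rule new_bishop_then_rook[OF b T]) (use completable_fast_rook le in simp)
qed

lemma completable_away_rook:
  assumes "ends_in_rook r T R ex ey" "T \<in> {A..E}" "0 \<le> d \<bullet> ex"
  shows completable
  by (rule rook_then_bishop[OF assms(1,2)], rule completable_away_bishop) (use assms(3) in auto)

lemma completable_new_bishop:
  assumes "ends_in_bishop r T R ex ey T" "T \<in> {A..E}"
  shows completable
  by (rule new_bishop_then_rook[OF assms], rule completable_away_rook) auto

text \<open>At most five further phases follow on the segment, alternately bishop and rook phases,
  the last of them a bishop phase from which the request recedes.\<close>

lemma completable_any_rook:
  assumes "ends_in_rook r T R ex ey" "T \<in> {A..E}"
  shows completable
  by (rule rook_then_bishop[OF assms], rule completable_new_bishop)

text \<open>The phase may have begun on an earlier segment, so its offset says nothing about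
  \<open>d\<close>, and the rook phase after it has to be treated without any assumption on the
  velocity.\<close>

lemma completable_meeting_bishop:
  assumes b: "ends_in_bishop r T R ex ey a" and T: "T \<in> {A..E}" and eq: "server R T = r T"
  shows completable
proof -
  from b have ax: "axes ex ey" and "a \<le> T" and ph: "bishop_phase r (server R) (offset R) ex ey a T"
    by (auto elim: ends_in_bishopE)
  define x where "x = (server R T - r a) \<bullet> ex"
  have off: "offset R T = - (x *\<^sub>R ex)"
    using bishop_phaseD(4)[OF ph, of T] \<open>a \<le> T\<close> by (simp add: x_def)
  define ex' where "ex' = (if 0 \<le> x then ex else - ex)"
  have "offset R T = - (norm (offset R T) *\<^sub>R ex')" unfolding off using ax by (simp add: ex'_def)
  moreover have "ex' \<in> {ex, - ex}" by (simp add: ex'_def)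
  ultimately obtain R' where "ends_in_rook r T R' ex' ey" using switch_to_rook[OF b eq] by blast
  then show ?thesis using T by (rule completable_any_rook)
qed

lemma completable_execution:
  assumes "br_execution r A R"
  shows completable
proof -
  have A: "A \<in> {A..E}" using unit_step_le[OF step] by simp
  show ?thesis
  proof (rule ends_in_cases[OF assms])
    fix ex ey assume "ends_in_rook r A R ex ey"
    then show ?thesis using A by (rule completable_any_rook)
  next
    fix ex ey a assume b: "ends_in_bishop r A R ex ey a"
    show ?thesis
    proof (cases "server R A = r A")
      case True
      then show ?thesis by (rule completable_meeting_bishop[OF b A])
    next
      case False
      then obtain T' R' where T': "A \<le> T'" "T' \<le> E" "ends_in_bishop r T' R' ex ey a"
        "T' = E \<or> server R' T' = r T'"
        using bishop_run[OF b _ r sub[OF A]] by metis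
      then show ?thesis
        using completable_bishop completable_meeting_bishop[OF T'(3)] by (cases "T' = E") auto
    qed
  qed
qed

end

lemma br_execution_exists:
  assumes r: "unit_affine r" "r 0 = 0"
  shows "\<exists>R. br_execution r (real n) R"
proof (induction n)
  case 0
  \<comment> \<open>A single bishop phase of duration zero. Server and request coincide, so the
    construction leaves it at once through a rook phase with offset 0, and the initial axes can be
    arbitrary.\<close>
  define R where "R = \<lparr>phases = 1, times = (\<lambda>_. 0), xaxis = (\<lambda>_. (1, 0)), yaxis = (\<lambda>_. (0, 1)),
    server = (\<lambda>_. 0), offset = (\<lambda>_. 0)\<rparr>"
  have "bishop_phase r (\<lambda>_. 0) (\<lambda>_. 0) (1, 0) (0, 1) 0 0"
    unfolding bishop_phase_def using r(2) by (simp add: zero_prod_def)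
  then have "br_execution r (real 0) R"
    unfolding br_execution_def R_def by (simp add: axes_def inner_prod_def zero_prod_def)
  then show ?case by blast
next
  case (Suc n)
  then obtain R where R: "br_execution r (real n) R" by blast
  obtain v where v: "\<And>t. t \<in> {real n..real n + 1} \<Longrightarrow> r t = r (real n) + (t - real n) *\<^sub>R v"
    using r(1) unfolding unit_affine_def by blast
  have "affine_on r v (real n) (real (Suc n))"
    unfolding affine_on_def
  proof (intro ballI)
    fix x y assume xy: "x \<in> {real n..real (Suc n)}" "y \<in> {real n..real (Suc n)}"
    have rx: "r x = r (real n) + (x - real n) *\<^sub>R v" and ry: "r y = r (real n) + (y - real n) *\<^sub>R v"
      using xy by (auto intro!: v)
    show "r y = r x + (y - x) *\<^sub>R v" unfolding rx ry by (simp add: scaleR_left_distrib[symmetric])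
  qed
  moreover have "unit_step (real n) (real (Suc n))"
    unfolding unit_step_def by (intro exI[of _ n]) auto
  ultimately interpret segment r v "real n" "real (Suc n)" using r by unfold_locales
  show ?case using completable_execution[OF R] unfolding completable_def .
qed

theorem theorem2:
  shows "(\<forall>p d n R q. cnn_input p d \<and> br_execution (request p) (real n) R \<and>
            feasible_server (request p) (real n) q \<longrightarrow>
            mono_on {0..real n} (potential R q)) \<and>
         competitive bishop_rook (3 + 2 * sqrt 3)"
proof
  show "\<forall>p d n R q. cnn_input p d \<and> br_execution (request p) (real n) R \<and>
      feasible_server (request p) (real n) q \<longrightarrow> mono_on {0..real n} (potential R q)"
    using potential_le[OF unit_affine_request] by (auto intro!: monotone_onI)
  show "competitive bishop_rook (3 + 2 * sqrt 3)"
    unfolding competitive_def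
  proof (intro allI impI)
    fix p d n assume p: "cnn_input p d"
    have r: "unit_affine (request p)" "request p 0 = 0"
      using unit_affine_request p by (auto simp: request_def cnn_input_def)
    show "bishop_rook (request p) (real n) \<noteq> {} \<and>
        (\<forall>s\<in>bishop_rook (request p) (real n). feasible_server (request p) (real n) s \<and>
          curve_length l1_dist s 0 (real n) \<le> (3 + 2 * sqrt 3) * opt_cost (request p) (real n))"
      using br_execution_exists[OF r, of n] br_feasible[OF r(1)] br_competitive[OF r]
      unfolding bishop_rook_def by auto
  qed
qed

end
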